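(* Let $\Gamma$ be a countable subgroup of $\mathrm{Diff}^1_+(\mathrm{S}^1)$ which preserves no probability measure on $\mathrm{S}^1$. Then $\Gamma$ contains an element $g$ which has fixed points and all of whose fixed points are hyperbolic.
   Context: $\mathrm{Diff}^1_+(\mathrm{S}^1)$ is the group of orientation-preserving $C^1$ diffeomorphisms of the circle. A fixed point $x$ of $g$ is hyperbolic if $g'(x)\neq 1$. $\Gamma$ preserves a probability measure $m$ if $g_*m=m$ for all $g\in\Gamma$. *)

theory Defs
  imports "HOL-Probability.Probability" "HOL-Algebra.Bij"
begin

abbreviation circle :: "complex set" where
  "circle \<equiv> sphere 0 1"

text \<open>
  For a differentiable \<open>g\<close> mapping the circle to itself, the curve \<open>t \<mapsto> g (cis t)\<close> has velocity
  \<open>g'(x) * \<i> * g x\<close> at \<open>x = cis t\<close>, because \<open>\<i> * g x\<close> is the positively oriented unit tangent vector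
  at \<open>g x\<close>; the quotient below is therefore real, and it is the usual derivative of a lift
  of \<open>g\<close> to the real line (see \<open>has_vector_derivative_circle_deriv\<close> and \<open>circle_deriv_lift\<close>).
\<close>

definition circle_deriv :: "(complex \<Rightarrow> complex) \<Rightarrow> complex \<Rightarrow> real" where
  "circle_deriv g x = Re (vector_derivative (\<lambda>t. g (cis t)) (at (Arg x)) / (\<i> * g x))"

definition C1_circle_map :: "(complex \<Rightarrow> complex) \<Rightarrow> bool" where
  "C1_circle_map g \<longleftrightarrow> g \<in> circle \<rightarrow> circle \<and> (\<lambda>t. g (cis t)) C1_differentiable_on UNIV"

text \<open>
  Elements are extensional (\<open>undefined\<close> off the circle), as in \<^const>\<open>BijGroup\<close>, so that equality of
  group elements is equality on the circle.
\<close>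

definition Diff1_plus :: "(complex \<Rightarrow> complex) monoid" where
  "Diff1_plus = (BijGroup circle)\<lparr>carrier :=
     {g \<in> Bij circle. C1_circle_map g \<and> C1_circle_map (inv_into circle g) \<and>
        (\<forall>x\<in>circle. circle_deriv g x > 0)}\<rparr>"

definition circle_prob_measure :: "complex measure \<Rightarrow> bool" where
  "circle_prob_measure m \<longleftrightarrow> prob_space m \<and> sets m = sets (restrict_space borel circle)"

text \<open>
  Only used for \<open>\<Gamma> \<subseteq> carrier Diff1_plus\<close>, whose elements are continuous on the circle and hence
  measurable, so that \<open>distr m m g\<close> is the push-forward.
\<close>

definition preserves_measure :: "(complex \<Rightarrow> complex) set \<Rightarrow> complex measure \<Rightarrow> bool" where
  "preserves_measure \<Gamma> m \<longleftrightarrow> (\<forall>g\<in>\<Gamma>. distr m m g = m)"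

definition hyperbolic_fixed_point :: "(complex \<Rightarrow> complex) \<Rightarrow> complex \<Rightarrow> bool" where
  "hyperbolic_fixed_point g x \<longleftrightarrow> x \<in> circle \<and> g x = x \<and> circle_deriv g x \<noteq> 1"

lemma has_vector_derivative_cis_shift:
  assumes "((\<lambda>s. g (cis s)) has_vector_derivative v) (at t)" and "cis a = cis t"
  shows "((\<lambda>s. g (cis s)) has_vector_derivative v) (at a)"
proof -
  have c: "cis (s + (t - a)) = cis s" for s
    using assms(2) by (simp add: cis_mult [symmetric] cis_divide [symmetric])
  have "((\<lambda>s. s + (t - a)) has_vector_derivative 1) (at a)"
    by (auto intro!: derivative_eq_intros)
  from vector_diff_chain_at [OF this, of "\<lambda>s. g (cis s)" v] assms(1)
  show ?thesis by (simp add: o_def c)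
qed

lemma circle_deriv_eqI:
  assumes "((\<lambda>s. g (cis s)) has_vector_derivative d *\<^sub>R (\<i> * g (cis t))) (at t)"
    and "g (cis t) \<noteq> 0"
  shows "circle_deriv g (cis t) = d"
proof -
  have "cis (Arg (cis t)) = cis t" by (simp add: cis_Arg sgn_eq)
  from has_vector_derivative_cis_shift [OF assms(1) this]
  have "vector_derivative (\<lambda>s. g (cis s)) (at (Arg (cis t))) = d *\<^sub>R (\<i> * g (cis t))"
    by (rule vector_derivative_at)
  then show ?thesis
    using assms(2) by (simp add: circle_deriv_def scaleR_conv_of_real)
qed

lemma has_vector_derivative_circle_deriv:
  assumes "C1_circle_map g"
  shows "((\<lambda>s. g (cis s)) has_vector_derivative
            circle_deriv g (cis t) *\<^sub>R (\<i> * g (cis t))) (at t)"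
proof -
  let ?f = "\<lambda>s. g (cis s)"
  obtain v where v: "(?f has_vector_derivative v) (at t)"
    using assms by (auto simp: C1_circle_map_def C1_differentiable_on_def)
  have n: "norm (?f s) = 1" for s
    using assms by (auto simp: C1_circle_map_def Pi_iff)
  have "((\<lambda>s. ?f s \<bullet> ?f s) has_derivative (\<lambda>x. ?f t \<bullet> (x *\<^sub>R v) + (x *\<^sub>R v) \<bullet> ?f t)) (at t)"
    using v by (auto intro!: derivative_eq_intros simp: has_vector_derivative_def)
  moreover have "(\<lambda>s. ?f s \<bullet> ?f s) = (\<lambda>s. 1)"
    using n by (simp add: dot_square_norm)
  ultimately have "((\<lambda>s::real. 1::real) has_derivative (\<lambda>x. ?f t \<bullet> (x *\<^sub>R v) + (x *\<^sub>R v) \<bullet> ?f t)) (at t)"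
    by simp
  then have "(\<lambda>x. ?f t \<bullet> (x *\<^sub>R v) + (x *\<^sub>R v) \<bullet> ?f t) = (\<lambda>x. 0)"
    by (rule has_derivative_unique) simp
  from fun_cong [OF this, of 1] have p: "?f t \<bullet> v = 0"
    by (simp add: inner_commute)
  have nt: "?f t \<noteq> 0" using n [of t] by auto
  define d where "d = Re (v / (\<i> * ?f t))"
  have "Im (v / (\<i> * ?f t)) = 0"
    using p by (simp add: Im_divide inner_complex_def algebra_simps)
  then have "v / (\<i> * ?f t) = of_real d"
    by (simp add: d_def complex_eq_iff)
  then have "v = d *\<^sub>R (\<i> * ?f t)"
    using nt by (simp add: divide_simps scaleR_conv_of_real)
  with v have "(?f has_vector_derivative d *\<^sub>R (\<i> * ?f t)) (at t)" by simp
  with circle_deriv_eqI [OF this nt] show ?thesis by simp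
qed

lemma has_vector_derivative_cis_comp:
  assumes "(G has_real_derivative d) (at t)"
  shows "((\<lambda>s. cis (G s)) has_vector_derivative d *\<^sub>R (\<i> * cis (G t))) (at t)"
proof -
  have "((\<lambda>s. \<i> * of_real (G s)) has_vector_derivative \<i> * of_real d) (at t)"
    using assms by (intro has_vector_derivative_mult_right has_vector_derivative_of_real)
  from field_vector_diff_chain_at [OF this DERIV_exp]
  show ?thesis by (simp add: o_def cis_conv_exp scaleR_conv_of_real mult_ac)
qed

lemma circle_deriv_lift:
  assumes "\<And>s. g (cis s) = cis (G s)" and "(G has_real_derivative d) (at t)"
  shows "circle_deriv g (cis t) = d"
proof (rule circle_deriv_eqI)
  show "((\<lambda>s. g (cis s)) has_vector_derivative d *\<^sub>R (\<i> * g (cis t))) (at t)"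
    unfolding assms(1) by (rule has_vector_derivative_cis_comp [OF assms(2)])
qed (simp add: assms(1))

lemma local_lift:
  assumes "C1_circle_map f"
  obtains \<theta> where "(\<theta> has_real_derivative circle_deriv f (cis t)) (at t)"
    "\<And>s. f (cis s) = cis (\<theta> s)"
proof -
  let ?h = "\<lambda>s. f (cis s)"
  let ?d = "circle_deriv f (cis t)"
  have n: "norm (?h s) = 1" for s
    using assms by (auto simp: C1_circle_map_def Pi_iff)
  then have nz: "?h s \<noteq> 0" for s by (metis norm_zero zero_neq_one)
  define q where "q = (\<lambda>s. ?h s / ?h t)"
  define \<theta> where "\<theta> = (\<lambda>s. Arg (?h t) + Im (Ln (q s)))"
  have qd: "(q has_vector_derivative ?d *\<^sub>R \<i>) (at t)"
    using has_vector_derivative_divide [OF has_vector_derivative_circle_deriv [OF assms, of t], of "?h t"] nz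
    by (simp add: q_def scaleR_conv_of_real)
  have qt: "q t = 1" using nz by (simp add: q_def)
  have "((\<lambda>s. Ln (q s)) has_vector_derivative (?d *\<^sub>R \<i>) * 1) (at t)"
    using field_vector_diff_chain_at [OF qd, of Ln 1] has_field_derivative_Ln [of 1] qt
    by (simp add: o_def)
  then have "((\<lambda>s. Im (Ln (q s))) has_real_derivative ?d) (at t)"
    unfolding has_vector_derivative_def has_field_derivative_def
    by (drule_tac bounded_linear.has_derivative [OF bounded_linear_Im]) (simp add: mult_commute_abs)
  then have 1: "(\<theta> has_real_derivative ?d) (at t)"
    using DERIV_add [OF DERIV_const] unfolding \<theta>_def by fastforce
  have 2: "?h s = cis (\<theta> s)" for s
  proof -
    have "cis (Im (Ln (q s))) = q s"
    proof -
      have nq: "norm (q s) = 1" by (simp add: q_def norm_divide n)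
      then have "q s \<noteq> 0" by auto
      then have "Arg (q s) = Im (Ln (q s))" by (simp add: Arg_eq_Im_Ln)
      with nq \<open>q s \<noteq> 0\<close> show ?thesis using cis_Arg [of "q s"] by (simp add: sgn_eq)
    qed
    moreover have "cis (Arg (?h t)) = ?h t" using nz n by (simp add: cis_Arg sgn_eq)
    ultimately show ?thesis using nz by (simp add: \<theta>_def cis_mult [symmetric] q_def)
  qed
  show thesis by (rule that [OF 1 2])
qed


lemma circle_deriv_continuous:
  assumes "C1_circle_map g"
  shows "continuous_on UNIV (\<lambda>t. circle_deriv g (cis t))"
proof -
  let ?f = "\<lambda>s. g (cis s)"
  obtain D where D: "\<And>t. (?f has_vector_derivative D t) (at t)" "continuous_on UNIV D"
    using assms by (auto simp: C1_circle_map_def C1_differentiable_on_def)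
  have nz: "?f s \<noteq> 0" for s
  proof -
    have "norm (?f s) = 1" using assms by (auto simp: C1_circle_map_def Pi_iff)
    then show ?thesis by auto
  qed
  have cf: "continuous_on UNIV ?f"
    using D(1) by (auto intro!: continuous_at_imp_continuous_on has_vector_derivative_continuous)
  have "D t = circle_deriv g (cis t) *\<^sub>R (\<i> * ?f t)" for t
    by (rule vector_derivative_unique_at [OF D(1) has_vector_derivative_circle_deriv [OF assms]])
  then have "circle_deriv g (cis t) = Re (D t / (\<i> * ?f t))" for t
    using nz [of t] by (simp add: scaleR_conv_of_real)
  moreover have "continuous_on UNIV (\<lambda>t. Re (D t / (\<i> * ?f t)))"
    using nz by (intro continuous_intros D cf) auto
  ultimately show ?thesis by simp
qed

lemma circle_obtain_cis:
  assumes "x \<in> circle" obtains t where "x = cis t"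
proof -
  have "x \<noteq> 0" using assms by auto
  then have "x = cis (Arg x)" using assms by (simp add: cis_Arg sgn_eq)
  then show thesis by (rule that)
qed

lemma C1_circle_map_comp:
  assumes f: "C1_circle_map f" and g: "C1_circle_map g"
    and h: "\<And>x. x \<in> circle \<Longrightarrow> h x = g (f x)"
  shows "C1_circle_map h"
    and "x \<in> circle \<Longrightarrow> circle_deriv h x = circle_deriv g (f x) * circle_deriv f x"
proof -
  let ?d = "\<lambda>t. circle_deriv g (f (cis t)) * circle_deriv f (cis t)"
  have m: "f \<in> circle \<rightarrow> circle" "g \<in> circle \<rightarrow> circle"
    using f g by (auto simp: C1_circle_map_def)
  then have hm: "h \<in> circle \<rightarrow> circle" using h by fastforce
  have hc: "h (cis s) = g (f (cis s))" for s by (simp add: h)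
  have d: "((\<lambda>s. h (cis s)) has_vector_derivative ?d t *\<^sub>R (\<i> * h (cis t))) (at t)"
   and c: "isCont (\<lambda>s. circle_deriv g (f (cis s))) t" for t
  proof -
    obtain \<theta> where th: "(\<theta> has_real_derivative circle_deriv f (cis t)) (at t)"
        "\<And>s. f (cis s) = cis (\<theta> s)"
      using local_lift [OF f] by metis
    have "(\<theta> has_vector_derivative circle_deriv f (cis t)) (at t)"
      using th(1) by (simp add: has_real_derivative_iff_has_vector_derivative)
    from vector_diff_chain_at [OF this has_vector_derivative_circle_deriv [OF g]]
    show "((\<lambda>s. h (cis s)) has_vector_derivative ?d t *\<^sub>R (\<i> * h (cis t))) (at t)"
      by (simp add: o_def hc th(2) mult.commute)
    have "isCont (\<lambda>s. circle_deriv g (cis s)) (\<theta> t)"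
      using circle_deriv_continuous [OF g] by (simp add: continuous_on_eq_continuous_at)
    then show "isCont (\<lambda>s. circle_deriv g (f (cis s))) t"
      unfolding th(2) using DERIV_isCont [OF th(1)] isCont_o2 by blast
  qed
  have ch: "continuous_on UNIV (\<lambda>s. h (cis s))"
    using d by (auto intro!: continuous_at_imp_continuous_on has_vector_derivative_continuous)
  have "continuous_on UNIV (\<lambda>t. ?d t *\<^sub>R (\<i> * h (cis t)))"
    by (intro continuous_intros ch circle_deriv_continuous [OF f])
       (use c in \<open>auto intro: continuous_at_imp_continuous_on\<close>)
  with d have "(\<lambda>s. h (cis s)) C1_differentiable_on UNIV"
    unfolding C1_differentiable_on_def
    by (intro exI [of _ "\<lambda>t. ?d t *\<^sub>R (\<i> * h (cis t))"]) simp
  with hm show "C1_circle_map h" by (simp add: C1_circle_map_def)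
  assume "x \<in> circle"
  then obtain t where t: "x = cis t" by (rule circle_obtain_cis)
  have "norm (h (cis t)) = 1" using hm by (auto simp: Pi_iff)
  then have "h (cis t) \<noteq> 0" by auto
  with circle_deriv_eqI [OF d] t
  show "circle_deriv h x = circle_deriv g (f x) * circle_deriv f x" by simp
qed

lemma C1_circle_map_cong:
  assumes "C1_circle_map g" and "\<And>x. x \<in> circle \<Longrightarrow> h x = g x"
  shows "C1_circle_map h"
proof -
  have "(\<lambda>s. h (cis s)) = (\<lambda>s. g (cis s))" using assms(2) by simp
  moreover have "h \<in> circle \<rightarrow> circle"
    using assms by (auto simp: C1_circle_map_def Pi_iff)
  ultimately show ?thesis using assms(1) by (simp add: C1_circle_map_def)
qed

lemma C1_circle_map_id:
  assumes "\<And>x. x \<in> circle \<Longrightarrow> h x = x"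
  shows "C1_circle_map h" and "x \<in> circle \<Longrightarrow> circle_deriv h x = 1"
proof -
  have h: "h (cis s) = cis s" for s by (simp add: assms)
  have d: "(cis has_vector_derivative \<i> * cis t) (at t)" for t
    using has_vector_derivative_cis_comp [of "\<lambda>s. s" 1 t] by simp
  have "continuous_on UNIV (\<lambda>t. \<i> * cis t)" by (intro continuous_intros)
  with d show "C1_circle_map h"
    unfolding C1_circle_map_def C1_differentiable_on_def h using assms
    by (auto intro!: exI [of _ "\<lambda>t. \<i> * cis t"])
  assume "x \<in> circle"
  then obtain t where t: "x = cis t" by (rule circle_obtain_cis)
  show "circle_deriv h x = 1" unfolding t by (rule circle_deriv_lift [of h "\<lambda>s. s"]) (simp_all add: h)
qed

lemma subgroup_Diff1_plus: "subgroup (carrier Diff1_plus) (BijGroup circle)"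
proof (rule group.subgroupI [OF group_BijGroup])
  show "carrier Diff1_plus \<subseteq> carrier (BijGroup circle)"
    by (auto simp: Diff1_plus_def BijGroup_def)
next
  let ?i = "\<lambda>x\<in>circle. x"
  have i: "inv_into circle ?i x = x" if "x \<in> circle" for x
    using that by (intro inv_into_f_eq) (auto simp: inj_on_def)
  have "?i \<in> carrier Diff1_plus"
    using C1_circle_map_id [of ?i] C1_circle_map_id [of "inv_into circle ?i"] i
    by (simp add: Diff1_plus_def id_Bij)
  then show "carrier Diff1_plus \<noteq> {}" by blast
next
  fix f assume "f \<in> carrier Diff1_plus"
  then have f: "f \<in> Bij circle" "C1_circle_map f" "C1_circle_map (inv_into circle f)"
      "\<And>x. x \<in> circle \<Longrightarrow> circle_deriv f x > 0"
    by (auto simp: Diff1_plus_def)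
  have bij: "bij_betw f circle circle" using f(1) by (simp add: Bij_def)
  let ?g = "\<lambda>x\<in>circle. inv_into circle f x"
  have g: "C1_circle_map ?g" by (rule C1_circle_map_cong [OF f(3)]) simp
  have gB: "?g \<in> Bij circle" by (rule restrict_inv_into_Bij [OF f(1)])
  have "inv_into circle ?g x = f x" if "x \<in> circle" for x
  proof (rule inv_into_f_eq)
    show "inj_on ?g circle" using gB by (auto simp: Bij_def bij_betw_def)
    show "f x \<in> circle" using bij that by (rule bij_betwE [rule_format])
    then show "?g (f x) = x" using bij that by (simp add: bij_betw_inv_into_left)
  qed
  then have gi: "C1_circle_map (inv_into circle ?g)" by (rule C1_circle_map_cong [OF f(2)])
  have "circle_deriv ?g x > 0" if x: "x \<in> circle" for x
  proof -
    have gx: "?g x \<in> circle" using gB x Bij_imp_funcset by blast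
    have id: "f (?g y) = y" if "y \<in> circle" for y
      using bij that by (simp add: bij_betw_inv_into_right)
    have "circle_deriv (\<lambda>y. f (?g y)) x = circle_deriv f (?g x) * circle_deriv ?g x"
      by (rule C1_circle_map_comp(2) [OF g f(2) refl x])
    moreover have "circle_deriv (\<lambda>y. f (?g y)) x = 1"
      by (rule C1_circle_map_id(2) [OF id x])
    ultimately have "circle_deriv f (?g x) * circle_deriv ?g x > 0" by simp
    then show ?thesis using f(4) [OF gx] by (simp add: zero_less_mult_iff)
  qed
  with gB g gi show "inv\<^bsub>BijGroup circle\<^esub> f \<in> carrier Diff1_plus"
    by (simp add: Diff1_plus_def inv_BijGroup f(1) del: restrict_apply)
next
  fix f g assume "f \<in> carrier Diff1_plus" "g \<in> carrier Diff1_plus"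
  then have f: "f \<in> Bij circle" "C1_circle_map f" "C1_circle_map (inv_into circle f)"
      "\<And>x. x \<in> circle \<Longrightarrow> circle_deriv f x > 0"
    and g: "g \<in> Bij circle" "C1_circle_map g" "C1_circle_map (inv_into circle g)"
      "\<And>x. x \<in> circle \<Longrightarrow> circle_deriv g x > 0"
    by (auto simp: Diff1_plus_def)
  let ?h = "compose circle f g"
  have bf: "bij_betw f circle circle" and bg: "bij_betw g circle circle"
    using f(1) g(1) by (simp_all add: Bij_def)
  have hB: "?h \<in> Bij circle" by (rule compose_Bij [OF f(1) g(1)])
  have h: "?h x = f (g x)" if "x \<in> circle" for x using that by (simp add: compose_def)
  have gx: "g x \<in> circle" if "x \<in> circle" for x using bg that by (rule bij_betwE [rule_format])
  have "inv_into circle ?h x = inv_into circle g (inv_into circle f x)" if x: "x \<in> circle" for x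
  proof (rule inv_into_f_eq)
    show "inj_on ?h circle" using hB by (auto simp: Bij_def bij_betw_def)
    have y: "inv_into circle f x \<in> circle" by (rule Bij_inv_into_mem [OF f(1) x])
    then show z: "inv_into circle g (inv_into circle f x) \<in> circle"
      by (rule Bij_inv_into_mem [OF g(1)])
    show "?h (inv_into circle g (inv_into circle f x)) = x"
      unfolding h [OF z] bij_betw_inv_into_right [OF bg y] bij_betw_inv_into_right [OF bf x] ..
  qed
  then have "C1_circle_map (inv_into circle ?h)"
    by (rule C1_circle_map_comp(1) [OF f(3) g(3)])
  moreover have "C1_circle_map ?h" by (rule C1_circle_map_comp(1) [OF g(2) f(2) h])
  moreover have "circle_deriv ?h x > 0" if "x \<in> circle" for x
    using C1_circle_map_comp(2) [OF g(2) f(2) h that] f(4) [OF gx [OF that]] g(4) [OF that] by simp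
  ultimately show "f \<otimes>\<^bsub>BijGroup circle\<^esub> g \<in> carrier Diff1_plus"
    using hB f(1) g(1) by (simp add: Diff1_plus_def BijGroup_def)
qed

lemma group_Diff1_plus: "group Diff1_plus"
  using subgroup.subgroup_is_group [OF subgroup_Diff1_plus group_BijGroup]
  by (simp add: Diff1_plus_def)

end

theory Submission
  imports Defs
begin

text \<open>
  Let \<open>L\<close> be the group of all lifts to the real line of elements of \<open>\<Gamma>\<close>, and suppose that \<open>\<Gamma>\<close> preserves no
  probability measure. Then \<open>\<Gamma>\<close> has no finite orbit, which would carry one, so a minimal closed \<open>L\<close>-invariant set \<open>K\<close> is perfect.

  Concentration. A short interval around a point of \<open>K\<close> defines a monotone map \<open>\<theta>\<close> commuting with \<open>L\<close>,
  which moves each point to the farthest right end of the translates of the interval that start before the next point of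
  \<open>K\<close>. If the number of steps of such maps needed to cross a period were unbounded, then counting steps would yield in the
  limit an \<open>L\<close>-invariant length, that is, a monotone function conjugating all lifts to translations
  (\<open>small_steps_imp_cocycle\<close>), and with it an invariant measure (\<open>invariant_measure_of_cocycle\<close>).
  So the number of steps is bounded however short the interval. By the pigeonhole principle, some fixed interval
  around a point \<open>p\<close> of \<open>K\<close> can then be contracted to \<open>p\<close> by elements of \<open>L\<close>. Let \<open>\<theta>\<close> be the map defined by that
  interval. An element contracting the interval from \<open>x\<close> to a point just below \<open>\<theta> x\<close> contracts all its images under the
  powers of \<open>\<theta>\<close> too, because it commutes with \<open>\<theta>\<close>. Finitely many of these fill the circle: there are finite sets \<open>A\<close> and
  \<open>B\<close> such that arbitrarily small neighbourhoods of \<open>B\<close> have their complement mapped into arbitrarily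
  small neighbourhoods of \<open>A\<close> by elements of \<open>\<Gamma>\<close> (\<open>finite_concentration\<close>).

  Ping-pong. As all orbits are infinite, B. H. Neumann's lemma on coverings of groups by cosets provides
  translates of \<open>A\<close> and \<open>B\<close> that are pairwise disjoint, and so two elements playing ping-pong (\<open>ping_pong_exists\<close>).

  Hyperbolicity. The \<open>2\<^sup>n\<close> positive words of length \<open>n\<close> in these two elements have disjoint images on the
  circle, so on average the images have length at most \<open>2 * pi / 2\<^sup>n\<close>. By averaging, some long word has
  exponentially small images for all of its suffixes, and the same holds for its inverse. Exponential decay absorbs the
  subexponential distortion of \<open>C\<^sup>1\<close> maps, so that the word has small derivative away from the repelling set and its
  inverse has small derivative away from the attracting set (\<open>long_words_contract\<close>, \<open>contracting_word\<close>). Since these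
  two regions cover the circle, no fixed point of a power of the word has derivative 1; and some power does have a fixed point by
  recurrence (\<open>hyperbolic_element\<close>).
\<close>

section \<open>Invariant measures\<close>

lemma emeasure_lborel_translate:
  fixes A :: "real set" assumes "A \<in> sets borel"
  shows "emeasure lborel {x. x + c \<in> A} = emeasure lborel A"
proof -
  have "emeasure (distr lborel borel ((+) c)) A = emeasure lborel A" by (simp add: lborel_distr_plus)
  then show ?thesis using assms by (subst (asm) emeasure_distr) (auto simp: vimage_def add.commute)
qed

lemma emeasure_periodic_window:
  fixes S :: "real set"
  assumes S: "S \<in> sets borel" and per: "\<And>x. x + P \<in> S \<longleftrightarrow> x \<in> S" and P: "0 < P"
  shows "emeasure lborel (S \<inter> {c..<c + P}) = emeasure lborel (S \<inter> {0..<P})"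
proof -
  define m where "m c = emeasure lborel (S \<inter> {c..<c + P})" for c
  have step: "m c = m d" if "c \<le> d" "d \<le> c + P" for c d
  proof -
    have "m c = emeasure lborel (S \<inter> {c..<d}) + emeasure lborel (S \<inter> {d..<c + P})"
      unfolding m_def using that S by (subst plus_emeasure) (auto intro!: arg_cong[of _ _ "emeasure lborel"])
    also have "emeasure lborel (S \<inter> {c..<d}) = emeasure lborel {x. x + P \<in> S \<inter> {c + P..<d + P}}"
      by (intro arg_cong[of _ _ "emeasure lborel"]) (auto simp: per)
    also have "\<dots> = emeasure lborel (S \<inter> {c + P..<d + P})"
      using S by (intro emeasure_lborel_translate) auto
    also have "\<dots> + emeasure lborel (S \<inter> {d..<c + P}) = m d"
      unfolding m_def using that S by (subst plus_emeasure) (auto intro!: arg_cong[of _ _ "emeasure lborel"])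
    finally show ?thesis .
  qed
  have nat: "m (c + of_nat k * P) = m c" for c k
  proof (induction k)
    case (Suc k)
    have "m (c + of_nat k * P) = m (c + of_nat (Suc k) * P)"
      using P by (intro step) (auto simp: algebra_simps)
    then show ?case using Suc by simp
  qed simp
  define n where "n = \<lfloor>c / P\<rfloor>"
  have n: "of_int n * P \<le> c" "c < (of_int n + 1) * P"
    unfolding n_def using floor_divide_lower[OF P] floor_divide_upper[OF P] by blast+
  have "m c = m (of_int n * P)" using n by (intro step[symmetric]) (auto simp: algebra_simps)
  also have "\<dots> = m 0"
  proof (cases "n \<ge> 0")
    case True
    then show ?thesis using nat[of 0 "nat n"] by simp
  next
    case False
    then show ?thesis using nat[of "of_int n * P" "nat (-n)"] by simp
  qed
  finally show ?thesis by (simp add: m_def)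
qed

text \<open>
  The measure is the law of \<open>cis (Q U)\<close>, where \<open>Q\<close> is the quantile function of \<open>F\<close> and \<open>U\<close> is uniform
  on the unit interval. Since \<open>F\<close> conjugates each lift to a translation, \<open>G (Q s) = Q (s + c)\<close>, and
  the law of \<open>U\<close> is invariant under translations modulo 1. The values of \<open>F\<close> at its jumps do not affect \<open>Q\<close>.
\<close>

lemma invariant_measure_of_cocycle:
  fixes F :: "real \<Rightarrow> real"
  assumes F: "mono F" "\<And>x. F (x + 2 * pi) = F x + 1"
    and lifts: "\<And>g. g \<in> \<Gamma> \<Longrightarrow> \<exists>G c. strict_mono G \<and> surj G \<and> (\<forall>x. g (cis x) = cis (G x)) \<and> (\<forall>x. F (G x) = F x + c)"
    and meas: "\<And>g. g \<in> \<Gamma> \<Longrightarrow> g \<in> measurable (restrict_space borel circle) (restrict_space borel circle)"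
  shows "\<exists>m. circle_prob_measure m \<and> preserves_measure \<Gamma> m"
proof -
  have up: "F (x + of_nat n * (2 * pi)) = F x + of_nat n" for x n
  proof (induction n)
    case (Suc n)
    then show ?case using F(2)[of "x + of_nat n * (2 * pi)"] by (simp add: algebra_simps)
  qed simp
  define Q where "Q s = Inf {x. s \<le> F x}" for s
  have ne: "{x. s \<le> F x} \<noteq> {}" for s
  proof -
    obtain n :: nat where "s - F 0 < of_nat n" using reals_Archimedean2 by blast
    then have "s \<le> F (0 + of_nat n * (2 * pi))" using up[of 0 n] by linarith
    then show ?thesis by blast
  qed
  have bdd: "bdd_below {x. s \<le> F x}" for s
  proof -
    obtain n :: nat where n: "F 0 - s < of_nat n" using reals_Archimedean2 by blast
    have "F (- (of_nat n * (2 * pi))) < s" using up[of "- (of_nat n * (2 * pi))" n] n by simp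
    then have "- (of_nat n * (2 * pi)) \<le> x" if "s \<le> F x" for x
      using monoD[OF F(1), of x "- (of_nat n * (2 * pi))"] that by linarith
    then show ?thesis by (intro bdd_belowI) auto
  qed
  have below: "F x < s" if "x < Q s" for x s
    using cInf_lower[OF _ bdd, of x s] that by (force simp: Q_def not_le)
  have above: "s \<le> F x" if "Q s < x" for x s
  proof -
    obtain y where "s \<le> F y" "y < x" using cInf_lessD[OF ne] \<open>Q s < x\<close> unfolding Q_def by blast
    then show ?thesis using monoD[OF F(1), of y x] by simp
  qed
  have shift: "G (Q s) = Q (s + c)" if G: "strict_mono G" "surj G" "\<And>x. F (G x) = F x + c" for G c s
  proof (rule ccontr)
    assume "G (Q s) \<noteq> Q (s + c)"
    then consider "G (Q s) < Q (s + c)" | "Q (s + c) < G (Q s)" by linarith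
    then show False
    proof cases
      case 1
      then obtain y where y: "G (Q s) < y" "y < Q (s + c)" using dense by blast
      obtain x where x: "y = G x" using G(2) by (metis surjD)
      have "Q s < x" using y(1) x strict_mono_less[OF G(1)] by simp
      then have "s \<le> F x" by (rule above)
      then show False using below[OF y(2)] G(3)[of x] x by simp
    next
      case 2
      then obtain y where y: "Q (s + c) < y" "y < G (Q s)" using dense by blast
      obtain x where x: "y = G x" using G(2) by (metis surjD)
      have "x < Q s" using y(2) x strict_mono_less[OF G(1)] by simp
      then have "F x < s" by (rule below)
      then show False using above[OF y(1)] G(3)[of x] x by simp
    qed
  qed
  define q where "q s = cis (Q s)" for s
  have "Q s + 2 * pi = Q (s + 1)" for s
    by (rule shift) (auto simp: strict_mono_def F(2) intro: surjI[of _ "\<lambda>x. x - 2 * pi"])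
  then have q_per: "q (s + 1) = q s" for s by (metis q_def cis_2pi cis_mult mult_1_right)
  have "mono Q" unfolding Q_def by (intro monoI cInf_superset_mono ne bdd) auto
  then have "q \<in> borel_measurable borel" unfolding q_def
    by (intro borel_measurable_continuous_on[of cis] borel_measurable_mono continuous_intros)
  then have qm: "q \<in> measurable borel (restrict_space borel circle)"
    by (intro measurable_restrict_space2) (auto simp: q_def)
  define U where "U = uniform_measure lborel {0..<1::real}"
  interpret U: prob_space U unfolding U_def by (intro prob_space_uniform_measure) auto
  have U: "emeasure U X = emeasure lborel (X \<inter> {0..<1})" if "X \<in> sets borel" for X
    using that by (simp add: U_def Int_commute divide_ennreal_def)
  have qU: "q \<in> measurable U (restrict_space borel circle)"
    using qm by (simp add: U_def cong: measurable_cong_sets)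
  define m where "m = distr U (restrict_space borel circle) q"
  have "circle_prob_measure m"
    unfolding circle_prob_measure_def m_def using U.prob_space_distr[OF qU] by simp
  moreover have "distr m m g = m" if g: "g \<in> \<Gamma>" for g
  proof (rule measure_eqI)
    fix A assume "A \<in> sets (distr m m g)"
    then have A: "A \<in> sets (restrict_space borel circle)" by (simp add: m_def)
    obtain G c where G: "strict_mono G" "surj G" "\<And>x. g (cis x) = cis (G x)" "\<And>x. F (G x) = F x + c"
      using lifts[OF g] by auto
    have gq: "g (q s) = q (s + c)" for s unfolding q_def G(3) by (simp add: shift[OF G(1,2,4)])
    define S where "S = q -` A"
    have S: "S \<in> sets borel" using measurable_sets[OF qm A] by (simp add: S_def)
    have gm: "g \<in> measurable m m" using meas[OF g] by (simp add: m_def cong: measurable_cong_sets)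
    have "emeasure (distr m m g) A = emeasure m (g -` A \<inter> space m)"
      using gm A by (subst emeasure_distr) (auto simp: m_def)
    also have "\<dots> = emeasure U (q -` (g -` A \<inter> space m) \<inter> space U)"
      using qU measurable_sets[OF gm, of A] A unfolding m_def by (subst emeasure_distr) auto
    also have "q -` (g -` A \<inter> space m) \<inter> space U = {s. s + c \<in> S}"
      using gq by (auto simp: S_def m_def U_def space_restrict_space q_def)
    also have "emeasure U {s. s + c \<in> S} = emeasure lborel ({s. s + c \<in> S} \<inter> {0..<1})"
      using S by (intro U) simp
    also have "{s. s + c \<in> S} \<inter> {0..<1} = {s. s + c \<in> S \<inter> {c..<c + 1}}" by auto
    also have "emeasure lborel \<dots> = emeasure lborel (S \<inter> {c..<c + 1})"
      using S by (intro emeasure_lborel_translate) auto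
    also have "\<dots> = emeasure lborel (S \<inter> {0..<1})"
      by (intro emeasure_periodic_window S) (auto simp: S_def q_per)
    also have "\<dots> = emeasure m A" unfolding m_def using U[OF S] qU A
      by (subst emeasure_distr) (auto simp: S_def U_def)
    finally show "emeasure (distr m m g) A = emeasure m A" .
  qed simp
  ultimately show ?thesis unfolding preserves_measure_def by blast
qed

lemma invariant_measure_of_finite_orbit:
  assumes "finite Z" "Z \<noteq> {}" "Z \<subseteq> circle" and bij: "\<And>g. g \<in> \<Gamma> \<Longrightarrow> bij_betw g Z Z"
    and meas: "\<And>g. g \<in> \<Gamma> \<Longrightarrow> g \<in> measurable (restrict_space borel circle) (restrict_space borel circle)"
  shows "\<exists>m. circle_prob_measure m \<and> preserves_measure \<Gamma> m"
proof -
  let ?C = "restrict_space borel circle"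
  define p where "p = pmf_of_set Z"
  \<comment> \<open>the value 1 off \<open>Z\<close> only serves to make \<open>r\<close> take its values in the circle\<close>
  define r :: "complex \<Rightarrow> complex" where "r x = (if x \<in> Z then x else 1)" for x
  define m where "m = distr (measure_pmf p) ?C r"
  have r: "r \<in> measurable (measure_pmf p) ?C" using assms(3) by (auto simp: r_def space_restrict_space)
  have "circle_prob_measure m"
    unfolding circle_prob_measure_def m_def using measure_pmf.prob_space_distr[OF r] by simp
  moreover have "distr m m g = m" if g: "g \<in> \<Gamma>" for g
  proof -
    have "distr m m g = distr m ?C g" by (rule distr_cong) (auto simp: m_def)
    also have "\<dots> = distr (measure_pmf p) ?C (g \<circ> r)"
      unfolding m_def by (rule distr_distr[OF meas[OF g] r])
    also have "\<dots> = distr (measure_pmf p) ?C (r \<circ> g)"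
    proof (rule measure_eqI)
      fix A assume A: "A \<in> sets (distr (measure_pmf p) ?C (g \<circ> r))"
      have rg: "r \<circ> g \<in> measurable (measure_pmf p) ?C"
        using assms(3) by (auto simp: r_def space_restrict_space)
      have gr: "g \<circ> r \<in> measurable (measure_pmf p) ?C" using measurable_comp[OF r meas[OF g]] .
      have eq: "(g \<circ> r) -` A \<inter> Z = (r \<circ> g) -` A \<inter> Z"
        using bij_betwE[OF bij[OF g]] by (auto simp: r_def)
      have "emeasure (measure_pmf p) ((g \<circ> r) -` A) = emeasure (measure_pmf p) ((r \<circ> g) -` A)"
        using eq assms(1,2) emeasure_Int_set_pmf[of p] unfolding p_def by (metis set_pmf_of_set)
      then show "emeasure (distr (measure_pmf p) ?C (g \<circ> r)) A = emeasure (distr (measure_pmf p) ?C (r \<circ> g)) A"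
        using A by (simp add: emeasure_distr[OF rg] emeasure_distr[OF gr])
    qed simp
    also have "\<dots> = distr (distr (measure_pmf p) (count_space UNIV) g) ?C r"
      using assms(3) by (subst distr_distr) (auto simp: r_def space_restrict_space)
    also have "distr (measure_pmf p) (count_space UNIV) g = measure_pmf (map_pmf g p)"
      by (simp add: map_pmf_rep_eq)
    also have "map_pmf g p = p" unfolding p_def
      using map_pmf_of_set_bij_betw[OF bij[OF g]] assms(1,2) by simp
    finally show ?thesis by (simp add: m_def)
  qed
  ultimately show ?thesis unfolding preserves_measure_def by blast
qed

section \<open>Moving a finite set off another\<close>

text \<open>
  A form of B. H. Neumann's lemma: a group is not covered by finitely many cosets of subgroups of
  infinite index, here the sets \<open>{g. g a = s}\<close>, which are cosets of the stabiliser of \<open>a\<close>. Induction on the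
  set \<open>A\<close> of points: some coset \<open>{g. g a = c a}\<close> is not among those listed for \<open>a\<close>, so it would have to be
  covered by the cosets listed for the other points; translating this cover replaces each coset
  listed for \<open>a\<close> by cosets for the other points, and \<open>a\<close> is eliminated.
\<close>

lemma no_finite_transporter_cover:
  fixes G :: "('a \<Rightarrow> 'a) set" and X :: "'a set"
  assumes ne: "G \<noteq> {}"
    and maps: "\<And>g x. g \<in> G \<Longrightarrow> x \<in> X \<Longrightarrow> g x \<in> X"
    and comp: "\<And>g h. g \<in> G \<Longrightarrow> h \<in> G \<Longrightarrow> \<exists>k\<in>G. \<forall>x\<in>X. k x = g (h x)"
    and inv: "\<And>g. g \<in> G \<Longrightarrow> \<exists>k\<in>G. \<forall>x\<in>X. k (g x) = x \<and> g (k x) = x"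
    and fin: "finite A" and AX: "A \<subseteq> X" and inf: "\<And>a. a \<in> A \<Longrightarrow> infinite ((\<lambda>g. g a) ` G)"
    and R: "finite R" "R \<subseteq> A \<times> X"
  shows "\<exists>g\<in>G. \<forall>(a, s)\<in>R. g a \<noteq> s"
  using fin AX inf R
proof (induction A arbitrary: R rule: finite_induct)
  case empty
  then show ?case using ne by auto
next
  case (insert a A)
  define S where "S = snd ` R"
  have "finite S" using insert.prems by (simp add: S_def)
  then obtain s0 where "s0 \<in> (\<lambda>g. g a) ` G" "s0 \<notin> S"
    using insert.prems(2)[of a] by (meson finite_subset insertI1 subsetI)
  then obtain c where c: "c \<in> G" "c a \<notin> S" by auto
  define R0 where "R0 = {r \<in> R. fst r \<noteq> a}"
  have R0: "finite R0" "R0 \<subseteq> A \<times> X" using insert.prems by (auto simp: R0_def)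
  have aX: "a \<in> X" using insert.prems by auto
  \<comment> \<open>\<open>y s\<close> carries the coset \<open>{g. g a = s}\<close> to the unlisted coset \<open>{g. g a = c a}\<close>\<close>
  have "\<exists>y. s \<in> S \<inter> (\<lambda>g. g a) ` G \<longrightarrow> y \<in> G \<and> (\<forall>g\<in>G. g a = s \<longrightarrow> (y \<circ> g) a = c a)
      \<and> (\<exists>y'\<in>G. \<forall>x\<in>X. y' (y x) = x)" for s
  proof (cases "s \<in> S \<inter> (\<lambda>g. g a) ` G")
    case True
    then obtain x where x: "x \<in> G" "s = x a" by auto
    obtain x' where x': "x' \<in> G" "\<And>z. z \<in> X \<Longrightarrow> x' (x z) = z" using inv[OF x(1)] by auto
    obtain y where y: "y \<in> G" "\<And>z. z \<in> X \<Longrightarrow> y z = c (x' z)" using comp[OF c(1) x'(1)] by auto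
    have "(y \<circ> g) a = c a" if "g \<in> G" "g a = s" for g
      using that x x' y maps aX by simp
    moreover obtain y' where "y' \<in> G" "\<And>z. z \<in> X \<Longrightarrow> y' (y z) = z" using inv[OF y(1)] by auto
    ultimately show ?thesis using y(1) by blast
  qed auto
  then obtain y where y: "\<And>s. s \<in> S \<inter> (\<lambda>g. g a) ` G \<Longrightarrow> y s \<in> G \<and>
     (\<forall>g\<in>G. g a = s \<longrightarrow> (y s \<circ> g) a = c a) \<and> (\<exists>y'\<in>G. \<forall>x\<in>X. y' (y s x) = x)"
    by metis
  then obtain y' where y': "\<And>s. s \<in> S \<inter> (\<lambda>g. g a) ` G \<Longrightarrow> y' s \<in> G \<and> (\<forall>x\<in>X. y' s (y s x) = x)"
    by metis
  define R1 where "R1 = R0 \<union> (\<lambda>(s, b, t). (b, y' s t)) ` ((S \<inter> (\<lambda>g. g a) ` G) \<times> R0)"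
  have "finite R1" "R1 \<subseteq> A \<times> X"
    using R0 \<open>finite S\<close> y' maps by (fastforce simp: R1_def)+
  then obtain g where g: "g \<in> G" "\<forall>(b, t)\<in>R1. g b \<noteq> t"
    using insert.IH[of R1] insert.prems by auto
  show ?case
  proof (cases "\<forall>(b, t)\<in>R. g b \<noteq> t")
    case True
    then show ?thesis using g by auto
  next
    case False
    then obtain b t where bt: "(b, t) \<in> R" "g b = t" by auto
    then have "b = a" using g by (force simp: R1_def R0_def)
    define s where "s = g a"
    have s: "s \<in> S \<inter> (\<lambda>g. g a) ` G" using bt \<open>b = a\<close> g(1) by (force simp: s_def S_def)
    obtain k where k: "k \<in> G" "\<And>x. x \<in> X \<Longrightarrow> k x = y s (g x)" using comp[of "y s" g] y[OF s] g by auto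
    have "k b' \<noteq> t'" if r: "(b', t') \<in> R" for b' t'
    proof (cases "b' = a")
      case True
      have "k a = c a" using k(2)[OF aX] y[OF s] g(1) by (auto simp: s_def)
      moreover have "t' \<in> S" using r by (force simp: S_def)
      ultimately show ?thesis using c True by auto
    next
      case False
      then have r0: "(b', t') \<in> R0" using r by (simp add: R0_def)
      then have "b' \<in> X" using R0(2) insert.prems by auto
      show ?thesis
      proof
        assume "k b' = t'"
        then have "y' s t' = g b'"
          using k(2)[OF \<open>b' \<in> X\<close>] y'[OF s] maps[OF g(1) \<open>b' \<in> X\<close>] by auto
        moreover have "(b', y' s t') \<in> R1" using s r0 unfolding R1_def by force
        ultimately show False using g by auto
      qed
    qed
    then show ?thesis using k(1) by auto
  qed
qed

lemma move_off_finite_set: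
  fixes G :: "('a \<Rightarrow> 'a) set" and X :: "'a set"
  assumes "G \<noteq> {}"
    and "\<And>g x. g \<in> G \<Longrightarrow> x \<in> X \<Longrightarrow> g x \<in> X"
    and "\<And>g h. g \<in> G \<Longrightarrow> h \<in> G \<Longrightarrow> \<exists>k\<in>G. \<forall>x\<in>X. k x = g (h x)"
    and "\<And>g. g \<in> G \<Longrightarrow> \<exists>k\<in>G. \<forall>x\<in>X. k (g x) = x \<and> g (k x) = x"
    and "finite A" "A \<subseteq> X" and "\<And>a. a \<in> A \<Longrightarrow> infinite ((\<lambda>g. g a) ` G)"
    and "finite S" "S \<subseteq> X"
  shows "\<exists>g\<in>G. g ` A \<inter> S = {}"
proof -
  have "\<exists>g\<in>G. \<forall>(a, s)\<in>A \<times> S. g a \<noteq> s"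
    by (rule no_finite_transporter_cover[where X = X and A = A]) (use assms in auto)
  then show ?thesis by fastforce
qed

section \<open>Groups of lifts and their minimal sets\<close>

text \<open>
  The lifts to the real line of a group of orientation-preserving homeomorphisms of the circle, all
  lifts of each element being taken; \<open>P\<close> is the length of the circle.
\<close>

locale lift_group =
  fixes L :: "(real \<Rightarrow> real) set" and P :: real
  assumes P_pos: "0 < P"
    and shift: "(\<lambda>x. x + P) \<in> L"
    and comp: "f \<in> L \<Longrightarrow> g \<in> L \<Longrightarrow> (\<lambda>x. f (g x)) \<in> L"
    and inverse: "f \<in> L \<Longrightarrow> \<exists>g\<in>L. \<forall>x. g (f x) = x \<and> f (g x) = x"
    and mono: "f \<in> L \<Longrightarrow> strict_mono f"
    and cont: "f \<in> L \<Longrightarrow> continuous_on UNIV f"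
    and periodic: "f \<in> L \<Longrightarrow> f (x + P) = f x + P"
begin

lemma id_in: "(\<lambda>x. x) \<in> L"
proof -
  obtain g where "g \<in> L" "\<And>x. g (x + P) = x" using inverse[OF shift] by auto
  then show ?thesis using comp[OF \<open>g \<in> L\<close> shift] by simp
qed

lemma less_iff: "f \<in> L \<Longrightarrow> f x < f y \<longleftrightarrow> x < y"
  using mono strict_mono_less by blast

lemma le_iff: "f \<in> L \<Longrightarrow> f x \<le> f y \<longleftrightarrow> x \<le> y"
  using mono strict_mono_less_eq by blast

lemma shift_nat: "(\<lambda>x. x + of_nat n * P) \<in> L"
proof (induction n)
  case (Suc n)
  then show ?case using comp[OF shift Suc] by (simp add: algebra_simps)
qed (use id_in in simp)

lemma shift_int: "(\<lambda>x. x + of_int n * P) \<in> L"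
proof (cases "n \<ge> 0")
  case True
  then show ?thesis using shift_nat[of "nat n"] by simp
next
  case False
  then obtain g where g: "g \<in> L" "\<And>x. g x + of_nat (nat (-n)) * P = x"
    using inverse[OF shift_nat[of "nat (-n)"]] by auto
  have "g x = x + of_int n * P" for x using g(2)[of x] False by simp
  then show ?thesis using g(1) by (metis ext)
qed

lemma periodic_int: "f \<in> L \<Longrightarrow> f (x + of_int n * P) = f x + of_int n * P"
proof (induction n arbitrary: x rule: int_induct[where k = 0])
  case (step1 i)
  then show ?case using periodic[of f "x + of_int i * P"] by (simp add: algebra_simps)
next
  case (step2 i)
  then show ?case using periodic[of f "x + of_int (i - 1) * P"] by (simp add: algebra_simps)
qed simp

lemma reduce: "\<exists>n::int. c \<le> x + of_int n * P \<and> x + of_int n * P < c + P"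
proof -
  define n where "n = - \<lfloor>(x - c) / P\<rfloor>"
  have "of_int \<lfloor>(x - c) / P\<rfloor> * P \<le> x - c" "x - c < (of_int \<lfloor>(x - c) / P\<rfloor> + 1) * P"
    using floor_divide_lower[OF P_pos] floor_divide_upper[OF P_pos] by blast+
  then show ?thesis by (intro exI[of _ n]) (simp add: n_def algebra_simps)
qed

text \<open>
  Zorn's lemma for open invariant proper subsets. A union of a chain of them stays proper because one
  period is compact and an invariant set containing a period is everything.
\<close>

lemma minimal_closed_invariant_set:
  obtains K where "closed K" "K \<noteq> {}" "\<And>g x. g \<in> L \<Longrightarrow> x \<in> K \<Longrightarrow> g x \<in> K"
    "\<And>x V. x \<in> K \<Longrightarrow> open V \<Longrightarrow> V \<inter> K \<noteq> {} \<Longrightarrow> \<exists>g\<in>L. g x \<in> V"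
proof -
  define \<A> where "\<A> = {U. open U \<and> U \<noteq> UNIV \<and> (\<forall>g\<in>L. \<forall>x\<in>U. g x \<in> U)}"
  have "\<exists>M\<in>\<A>. \<forall>X\<in>\<A>. M \<subseteq> X \<longrightarrow> X = M"
  proof (rule subset_Zorn_nonempty)
    show "\<A> \<noteq> {}" by (auto simp: \<A>_def intro!: exI[of _ "{}"])
    fix C assume C: "C \<noteq> {}" "subset.chain \<A> C"
    then have sub: "C \<subseteq> \<A>" by (simp add: subset.chain_def)
    have "\<Union>C \<noteq> UNIV"
    proof
      assume "\<Union>C = UNIV"
      then have "compact {0..P}" "{0..P} \<subseteq> \<Union>C" "\<And>U. U \<in> C \<Longrightarrow> open U"
        using sub by (auto simp: \<A>_def)
      then obtain D where D: "D \<subseteq> C" "finite D" "{0..P} \<subseteq> \<Union>D"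
        by (metis compactE)
      have "D \<noteq> {}" using D(3) P_pos by auto
      moreover have "subset.chain \<A> D" using C(2) D(1) unfolding subset.chain_def by blast
      ultimately have "\<Union>D \<in> D" using D(2) Union_in_chain by blast
      then obtain U where U: "U \<in> C" "{0..P} \<subseteq> U" using D by auto
      have "x \<in> U" for x
      proof -
        obtain n :: int where "0 \<le> x + of_int n * P" "x + of_int n * P < 0 + P"
          using reduce[of 0 x] by blast
        then have "x + of_int n * P \<in> U" using U by auto
        moreover have "g y \<in> U" if "g \<in> L" "y \<in> U" for g y using that U(1) sub by (auto simp: \<A>_def)
        ultimately have "(x + of_int n * P) + of_int (-n) * P \<in> U" using shift_int[of "-n"] by blast
        then show ?thesis by simp
      qed
      then show False using U(1) sub by (auto simp: \<A>_def)
    qed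
    then show "\<Union>C \<in> \<A>" using sub by (fastforce simp: \<A>_def)
  qed
  then obtain M where M: "M \<in> \<A>" "\<And>X. X \<in> \<A> \<Longrightarrow> M \<subseteq> X \<Longrightarrow> X = M" by blast
  show ?thesis
  proof (rule that[of "- M"])
    show "closed (- M)" "- M \<noteq> {}" using M by (auto simp: \<A>_def)
    show "g x \<in> - M" if g: "g \<in> L" "x \<in> - M" for g x
    proof
      assume "g x \<in> M"
      moreover obtain h where "h \<in> L" "h (g x) = x" using inverse[OF g(1)] by auto
      ultimately have "x \<in> M" using M(1) by (force simp: \<A>_def)
      then show False using g by simp
    qed
    show "\<exists>g\<in>L. g x \<in> V" if x: "x \<in> - M" and V: "open V" "V \<inter> - M \<noteq> {}" for x V
    proof (rule ccontr)
      assume c: "\<not> ?thesis"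
      define W where "W = (\<Union>g\<in>L. g -` V)"
      have "open W" unfolding W_def
        using cont V(1) by (intro open_UN ballI open_vimage) auto
      have inv: "g y \<in> W" if g: "g \<in> L" "y \<in> W" for g y
      proof -
        obtain h where h: "h \<in> L" "h y \<in> V" using g by (auto simp: W_def)
        obtain k where k: "k \<in> L" "k (g y) = y" using inverse[OF g(1)] by auto
        then show ?thesis unfolding W_def
          using comp[OF h(1) k(1)] h(2) by (intro UN_I[of "\<lambda>x. h (k x)"]) auto
      qed
      have "x \<notin> M \<union> W" using x c by (auto simp: W_def)
      then have "M \<union> W \<in> \<A>" using M(1) inv \<open>open W\<close> by (auto simp: \<A>_def)
      then have "W \<subseteq> M" using M(2) by blast
      moreover have "V \<subseteq> W" using id_in by (auto simp: W_def)
      ultimately show False using V(2) by auto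
    qed
  qed
qed

end

locale minimal_lift_group = lift_group +
  fixes K :: "real set"
  assumes closed_K: "closed K" and ne_K: "K \<noteq> {}"
    and inv_K: "g \<in> L \<Longrightarrow> x \<in> K \<Longrightarrow> g x \<in> K"
    and dense_K: "x \<in> K \<Longrightarrow> open V \<Longrightarrow> V \<inter> K \<noteq> {} \<Longrightarrow> \<exists>g\<in>L. g x \<in> V"
    and infinite_K: "infinite (K \<inter> {0..<P})"
begin

lemma K_unbounded: "\<exists>z\<in>K. a \<le> z \<and> z < a + P"
proof -
  obtain z where z: "z \<in> K" using ne_K by auto
  obtain n :: int where "a \<le> z + of_int n * P" "z + of_int n * P < a + P" using reduce[of a z] by auto
  then show ?thesis using inv_K[OF shift_int[of n] z] by auto
qed

text \<open>
  The limit points of \<open>K\<close> form a closed invariant set, which is not empty, so minimality makes it all of \<open>K\<close>.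
\<close>

lemma K_perfect:
  assumes "k \<in> K"
  shows "k islimpt K"
proof -
  have "\<exists>x\<in>{0..P}. x islimpt (K \<inter> {0..<P})"
    using infinite_K by (intro Heine_Borel_imp_Bolzano_Weierstrass) auto
  then obtain q where q: "q islimpt K" using islimpt_subset by blast
  then have qK: "q \<in> K" using closed_K closed_limpt by blast
  show ?thesis
  proof (rule islimptI)
    fix V assume V: "k \<in> V" "open V"
    then obtain g where g: "g \<in> L" "g q \<in> V" using dense_K[OF qK] assms by blast
    show "\<exists>y\<in>K. y \<in> V \<and> y \<noteq> k"
    proof (cases "g q = k")
      case True
      have "open (g -` V)" using cont[OF g(1)] V by (intro open_vimage) auto
      then obtain z where z: "z \<in> K" "g z \<in> V" "z \<noteq> q" using islimptE[OF q, of "g -` V"] g(2) by auto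
      then have "g z \<noteq> g q" using mono[OF g(1)] by (metis strict_mono_eq)
      then show ?thesis using z inv_K[OF g(1)] True by auto
    next
      case False
      then show ?thesis using g inv_K[OF g(1) qK] by auto
    qed
  qed
qed

text \<open>
  A point of \<open>K\<close> that is isolated from the left is preceded by a gap of \<open>K\<close>, and the left end point of
  that gap, not being isolated, is accumulated from the left.
\<close>

lemma left_accumulation_point:
  obtains p where "p \<in> K" "\<And>\<delta>. \<delta> > 0 \<Longrightarrow> \<exists>z\<in>K. p - \<delta> < z \<and> z < p"
proof -
  obtain k where k: "k \<in> K" using ne_K by auto
  show ?thesis
  proof (cases "\<forall>\<delta>>0. \<exists>z\<in>K. k - \<delta> < z \<and> z < k")
    case True
    then show ?thesis using that k by blast
  next
    case False
    then obtain \<delta> where \<delta>: "\<delta> > 0" "\<And>z. z \<in> K \<Longrightarrow> k - \<delta> < z \<Longrightarrow> \<not> z < k" by auto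
    define S where "S = K \<inter> {..k - \<delta>}"
    define q where "q = Sup S"
    have S: "S \<noteq> {}" "bdd_above S" "closed S"
      using K_unbounded[of "k - \<delta> - P"] closed_K by (auto simp: S_def intro: closed_Int)
    then have qS: "q \<in> S" unfolding q_def by (rule closed_contains_Sup)
    have gap: "\<not> (q < z \<and> z < k)" if "z \<in> K" for z
      using that cSup_upper[of z S] S \<delta>(2)[of z] by (force simp: S_def q_def)
    have "\<exists>z\<in>K. q - \<epsilon> < z \<and> z < q" if \<epsilon>: "\<epsilon> > 0" for \<epsilon>
    proof -
      have "q \<in> K" "q < k" using qS \<delta>(1) by (auto simp: S_def)
      then obtain z where "z \<in> K" "z \<noteq> q" "z \<in> {q - \<epsilon><..<k}"
        using islimptE[OF K_perfect[of q], of "{q - \<epsilon><..<k}"] \<epsilon> by auto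
      then show ?thesis using gap[of z] by (intro bexI[of _ z]) auto
    qed
    then show ?thesis using that[of q] qS by (auto simp: S_def)
  qed
qed

end

section \<open>Commuting maps and invariant lengths\<close>

context lift_group begin

text \<open>
  A map commuting with \<open>L\<close> serves as an invariant yardstick: the number of its steps between two points
  does not change when an element of \<open>L\<close> is applied to both.
\<close>

definition stepping :: "(real \<Rightarrow> real) \<Rightarrow> bool" where
  "stepping \<theta> \<longleftrightarrow> mono \<theta> \<and> (\<forall>g\<in>L. \<forall>x. \<theta> (g x) = g (\<theta> x)) \<and> (\<forall>x. x < \<theta> x)
     \<and> (\<forall>x y. \<exists>n. y < (\<theta> ^^ n) x)"

definition steps :: "(real \<Rightarrow> real) \<Rightarrow> real \<Rightarrow> real \<Rightarrow> nat" where
  "steps \<theta> x y = (LEAST n. y < (\<theta> ^^ Suc n) x)"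

context
  fixes \<theta> assumes \<theta>: "stepping \<theta>"
begin

lemma iterate_mono: "x \<le> y \<Longrightarrow> (\<theta> ^^ n) x \<le> (\<theta> ^^ n) y"
  using \<theta> by (induction n) (auto simp: stepping_def mono_def)

lemma iterate_commute: "g \<in> L \<Longrightarrow> (\<theta> ^^ n) (g x) = g ((\<theta> ^^ n) x)"
  using \<theta> by (induction n) (auto simp: stepping_def)

lemma iterate_le: "m \<le> n \<Longrightarrow> (\<theta> ^^ m) x \<le> (\<theta> ^^ n) x"
proof (rule lift_Suc_mono_le[of "\<lambda>n. (\<theta> ^^ n) x"])
  show "(\<theta> ^^ n) x \<le> (\<theta> ^^ Suc n) x" for n using \<theta> by (simp add: stepping_def less_imp_le)
qed

lemma less_steps: "y < (\<theta> ^^ Suc (steps \<theta> x y)) x"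
proof -
  obtain n where "y < (\<theta> ^^ n) x" using \<theta> unfolding stepping_def by blast
  then have "y < (\<theta> ^^ Suc n) x" using iterate_le[of n "Suc n" x] by simp
  then show ?thesis unfolding steps_def by (rule LeastI)
qed

lemma steps_le: "x \<le> y \<Longrightarrow> (\<theta> ^^ steps \<theta> x y) x \<le> y"
proof (cases "steps \<theta> x y")
  case (Suc n)
  then show ?thesis using not_less_Least[of n "\<lambda>n. y < (\<theta> ^^ Suc n) x"] by (simp add: steps_def)
qed simp

lemma le_stepsI: "(\<theta> ^^ k) x \<le> y \<Longrightarrow> k \<le> steps \<theta> x y"
  using less_steps[of y x] iterate_le[of "Suc (steps \<theta> x y)" k x] by (meson leD le_trans not_less_eq_eq order_trans)

lemma steps_lessI: "x \<le> y \<Longrightarrow> y < (\<theta> ^^ k) x \<Longrightarrow> steps \<theta> x y < k"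
  using steps_le[of x y] iterate_le[of k "steps \<theta> x y" x] by (meson leD le_less_trans not_le)

lemma steps_add_le:
  assumes "x \<le> y" "y \<le> z"
  shows "steps \<theta> x y + steps \<theta> y z \<le> steps \<theta> x z"
proof (rule le_stepsI)
  have "(\<theta> ^^ (steps \<theta> y z + steps \<theta> x y)) x \<le> (\<theta> ^^ steps \<theta> y z) y"
    unfolding funpow_add by (simp add: iterate_mono steps_le assms)
  also have "\<dots> \<le> z" using steps_le assms by simp
  finally show "(\<theta> ^^ (steps \<theta> x y + steps \<theta> y z)) x \<le> z" by (simp add: add.commute)
qed

lemma steps_le_add:
  assumes "x \<le> y" "y \<le> z"
  shows "steps \<theta> x z \<le> steps \<theta> x y + steps \<theta> y z + 1"
proof -
  have "z < (\<theta> ^^ Suc (steps \<theta> y z)) y" by (rule less_steps)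
  also have "\<dots> \<le> (\<theta> ^^ Suc (steps \<theta> y z)) ((\<theta> ^^ Suc (steps \<theta> x y)) x)"
    using less_steps[of y x] by (intro iterate_mono) simp
  also have "\<dots> = (\<theta> ^^ (Suc (steps \<theta> y z) + Suc (steps \<theta> x y))) x"
    by (simp only: funpow_add o_apply)
  finally have "steps \<theta> x z < Suc (steps \<theta> y z) + Suc (steps \<theta> x y)"
    using assms by (intro steps_lessI) auto
  then show ?thesis by simp
qed

lemma steps_invariant: "g \<in> L \<Longrightarrow> steps \<theta> (g x) (g y) = steps \<theta> x y"
  unfolding steps_def using iterate_commute[of g] less_iff[of g] by presburger

lemma steps_periods: "steps \<theta> 0 (of_nat j * P) \<le> j * (steps \<theta> 0 P + 1)"
proof (induction j)
  case 0
  have "steps \<theta> 0 0 < 1" using \<theta> by (intro steps_lessI) (auto simp: stepping_def)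
  then show ?case by simp
next
  case (Suc j)
  have "steps \<theta> 0 (of_nat (Suc j) * P) \<le> steps \<theta> 0 (of_nat j * P) + steps \<theta> (of_nat j * P) (of_nat (Suc j) * P) + 1"
    using P_pos by (intro steps_le_add) auto
  also have "steps \<theta> (of_nat j * P) (of_nat (Suc j) * P) = steps \<theta> 0 P"
    using steps_invariant[OF shift_nat[of j], of 0 P] by (simp add: algebra_simps)
  finally show ?case using Suc by simp
qed

lemma steps_bound:
  assumes "x \<le> y" "\<bar>x\<bar> \<le> of_nat j * P" "\<bar>y\<bar> \<le> of_nat j * P"
  shows "steps \<theta> x y \<le> 2 * j * (steps \<theta> 0 P + 1)"
proof -
  let ?a = "- (of_nat j * P)" and ?b = "of_nat j * P"
  have le: "?a \<le> x" "y \<le> ?b" "x \<le> ?b" using assms by linarith+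
  have "steps \<theta> x y \<le> steps \<theta> x ?b" using steps_add_le[of x y ?b] assms(1) le by linarith
  also have "\<dots> \<le> steps \<theta> ?a ?b" using steps_add_le[of ?a x ?b] le by linarith
  also have "\<dots> = steps \<theta> 0 (of_nat (2 * j) * P)"
    using steps_invariant[OF shift_nat[of j], of ?a ?b] by (simp add: algebra_simps)
  finally show ?thesis using steps_periods[of "2 * j"] by simp
qed

end

lemma cocycle_of_invariant_length:
  assumes add: "\<And>x y z. x \<le> y \<Longrightarrow> y \<le> z \<Longrightarrow> d x z = d x y + (d y z :: real)"
    and nonneg: "\<And>x y. 0 \<le> d x y"
    and inv: "\<And>g x y. g \<in> L \<Longrightarrow> d (g x) (g y) = d x y" and unit: "d 0 P = 1"
  obtains F :: "real \<Rightarrow> real" where "mono F" "\<And>x. F (x + P) = F x + 1" "\<And>g. g \<in> L \<Longrightarrow> \<exists>c. \<forall>x. F (g x) = F x + c"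
proof -
  define F where "F x = (if 0 \<le> x then d 0 x else - d x 0)" for x
  have refl: "d x x = 0" for x using add[of x x x] by simp
  have F: "F y - F x = d x y" if "x \<le> y" for x y
    using that add[of 0 x y] add[of x 0 y] add[of x y 0] by (auto simp: F_def)
  have cst: "F (g y) - F (g x) = F y - F x" if "g \<in> L" for g x y
  proof (cases "x \<le> y")
    case True
    then show ?thesis using F[of x y] F[of "g x" "g y"] inv that le_iff by simp
  next
    case False
    then show ?thesis using F[of y x] F[of "g y" "g x"] inv that le_iff by simp
  qed
  show ?thesis
  proof (rule that)
    show "mono F" using F nonneg by (intro monoI) (metis diff_ge_0_iff_ge)
    show "F (x + P) = F x + 1" for x
      using cst[OF shift, of x 0] F[of 0 P] P_pos unit by (simp add: refl F_def)
    show "\<exists>c. \<forall>x. F (g x) = F x + c" if "g \<in> L" for g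
    proof (intro exI[of _ "F (g 0) - F 0"] allI)
      show "F (g x) = F x + (F (g 0) - F 0)" for x using cst[OF that, of x 0] by linarith
    qed
  qed
qed

text \<open>
  Counts of steps of \<open>\<theta>\<close> are exactly invariant and additive up to an error 1. Divided by the count for one
  period they are additive up to \<open>1 / N\<close> once a period takes at least \<open>N\<close> steps. The normalised counts
  lie in a product of compact intervals that does not depend on \<open>N\<close>, so by Tychonoff's theorem there is
  one function satisfying all these conditions at once: an invariant length that is exactly additive.
\<close>

lemma small_steps_imp_cocycle:
  assumes small: "\<And>N. \<exists>\<theta>. stepping \<theta> \<and> (\<theta> ^^ N) 0 \<le> P"
  obtains F :: "real \<Rightarrow> real" where "mono F" "\<And>x. F (x + P) = F x + 1" "\<And>g. g \<in> L \<Longrightarrow> \<exists>c. \<forall>x. F (g x) = F x + c"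
proof -
  define j where "j x = nat \<lceil>\<bar>x\<bar> / P\<rceil>" for x :: real
  have j: "\<bar>x\<bar> \<le> of_nat (j x) * P" for x
  proof -
    have "\<bar>x\<bar> / P \<le> of_nat (j x)" unfolding j_def by linarith
    then show ?thesis using P_pos by (simp add: field_simps)
  qed
  \<comment> \<open>the bound on the normalised counts, from \<open>steps_bound\<close> and \<open>M + 1 \<le> 2 * M\<close>\<close>
  define b where "b = (\<lambda>(x, y). 4 * real (max (j x) (j y)))"
  define S where "S = PiE UNIV (\<lambda>p. {0..b p})"
  have "compactin (product_topology (\<lambda>_. euclidean) UNIV) S"
    unfolding S_def by (subst compactin_PiE) auto
  then have "compact S" by (simp add: euclidean_product_topology compactin_euclidean_iff)
  define C where "C N = {d :: real \<times> real \<Rightarrow> real.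
      (\<forall>x y z. x \<le> y \<longrightarrow> y \<le> z \<longrightarrow> \<bar>d (x, z) - d (x, y) - d (y, z)\<bar> \<le> 1 / real (Suc N))
      \<and> (\<forall>g\<in>L. \<forall>x y. d (g x, g y) = d (x, y)) \<and> d (0, P) = 1}" for N
  have closed_C: "closed (C N)" for N unfolding C_def Ball_def
    by (intro closed_Collect_conj closed_Collect_all closed_Collect_imp 
          open_Collect_const closed_Collect_le closed_Collect_eq continuous_intros
          continuous_on_product_coordinates)
  have anti: "C M \<subseteq> C N" if "N \<le> M" for M N
  proof -
    have "1 / real (Suc M) \<le> 1 / real (Suc N)" using that by (simp add: frac_le)
    then show ?thesis unfolding C_def by (blast intro: order_trans)
  qed
  have ne: "S \<inter> C N \<noteq> {}" for N
  proof -
    obtain \<theta> where \<theta>: "stepping \<theta>" "(\<theta> ^^ Suc N) 0 \<le> P" using small by blast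
    define M where "M = steps \<theta> 0 P"
    have M: "Suc N \<le> M" unfolding M_def by (rule le_stepsI[OF \<theta>])
    define d where "d = (\<lambda>(x, y). if x \<le> y then real (steps \<theta> x y) / M else 0)"
    have "d (x, y) \<le> b (x, y)" for x y
    proof (cases "x \<le> y")
      case True
      let ?j = "max (j x) (j y)"
      have "real (j x) * P \<le> real ?j * P" "real (j y) * P \<le> real ?j * P" using P_pos by (auto intro!: mult_right_mono)
      then have "steps \<theta> x y \<le> 2 * ?j * (M + 1)" unfolding M_def
        using steps_bound[OF \<theta>(1) True, of ?j] j[of x] j[of y] by linarith
      also have "\<dots> \<le> 2 * ?j * (2 * M)" using M by (intro mult_left_mono) auto
      finally have "real (steps \<theta> x y) \<le> real (2 * ?j * (2 * M))" by (simp only: of_nat_le_iff)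
      then have "real (steps \<theta> x y) \<le> 4 * real ?j * M" by (simp del: of_nat_max)
      then show ?thesis using M True by (simp add: d_def b_def divide_le_eq)
    qed (simp add: d_def b_def)
    then have "d \<in> S" by (auto simp: S_def d_def)
    moreover have "d \<in> C N"
    proof -
      have "\<bar>d (x, z) - d (x, y) - d (y, z)\<bar> \<le> 1 / real (Suc N)" if "x \<le> y" "y \<le> z" for x y z
      proof -
        have "\<bar>real (steps \<theta> x z) - real (steps \<theta> x y) - real (steps \<theta> y z)\<bar> \<le> 1"
          using steps_add_le[OF \<theta>(1) that] steps_le_add[OF \<theta>(1) that] by linarith
        moreover have "d (x, z) - d (x, y) - d (y, z)
            = (real (steps \<theta> x z) - real (steps \<theta> x y) - real (steps \<theta> y z)) / M"
          using that by (simp add: d_def diff_divide_distrib)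
        ultimately have "\<bar>d (x, z) - d (x, y) - d (y, z)\<bar> \<le> 1 / real M"
          using M by (simp add: divide_right_mono)
        also have "\<dots> \<le> 1 / real (Suc N)" using M by (intro divide_left_mono) auto
        finally show ?thesis .
      qed
      moreover have "d (0, P) = 1" using P_pos M by (simp add: d_def M_def)
      moreover have "d (g x, g y) = d (x, y)" if "g \<in> L" for g x y
        using steps_invariant[OF \<theta>(1) that] le_iff[OF that] by (simp add: d_def)
      ultimately show ?thesis unfolding C_def by blast
    qed
    ultimately show ?thesis by blast
  qed
  have "S \<inter> (\<Inter>N\<in>UNIV. C N) \<noteq> {}"
  proof (rule compact_imp_fip_image[OF \<open>compact S\<close>])
    fix I :: "nat set" assume "finite I"
    then have "C (Max (insert 0 I)) \<subseteq> C N" if "N \<in> I" for N using that by (intro anti Max_ge) auto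
    then have "C (Max (insert 0 I)) \<subseteq> (\<Inter>N\<in>I. C N)" by blast
    then show "S \<inter> (\<Inter>N\<in>I. C N) \<noteq> {}" using ne by blast
  qed (rule closed_C)
  then obtain d where d: "d \<in> S" "\<And>N. d \<in> C N" by auto
  show ?thesis
  proof (rule cocycle_of_invariant_length[of "\<lambda>x y. d (x, y)"])
    show "d (x, z) = d (x, y) + d (y, z)" if "x \<le> y" "y \<le> z" for x y z
    proof -
      have "\<bar>d (x, z) - d (x, y) - d (y, z)\<bar> \<le> 1 / real (Suc N)" for N
        using d(2)[of N] that unfolding C_def by blast
      then have "\<not> 0 < \<bar>d (x, z) - d (x, y) - d (y, z)\<bar>"
        using reals_Archimedean[of "\<bar>d (x, z) - d (x, y) - d (y, z)\<bar>"] by (metis inverse_eq_divide not_less)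
      then show ?thesis by simp
    qed
    show "0 \<le> d (x, y)" for x y using d(1) by (auto simp: S_def)
    show "d (g x, g y) = d (x, y)" if "g \<in> L" for g x y using d(2)[of 0] that by (simp add: C_def)
    show "d (0, P) = 1" using d(2)[of 0] by (simp add: C_def)
  qed (use that in blast)
qed

end

section \<open>Concentration near a finite set\<close>

definition (in lift_group) near :: "real set \<Rightarrow> real \<Rightarrow> real \<Rightarrow> bool" where
  "near A \<epsilon> x \<longleftrightarrow> (\<exists>a\<in>A. \<exists>n::int. \<bar>x - (a + of_int n * P)\<bar> < \<epsilon>)"

text \<open>
  Lower semicontinuity from the left, which for a monotone function is left-continuity. Demanding the
  inequality at all points to the right of \<open>w\<close> makes the property stable under composition.
\<close>

definition left_cont :: "(real \<Rightarrow> real) \<Rightarrow> bool" where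
  "left_cont f \<longleftrightarrow> (\<forall>x. \<forall>y<f x. \<exists>w<x. \<forall>x'>w. y < f x')"

lemma left_cont_funpow: "left_cont f \<Longrightarrow> left_cont (f ^^ n)"
proof (induction n)
  case 0
  then show ?case by (auto simp: left_cont_def)
next
  case (Suc n)
  show ?case unfolding left_cont_def
  proof (intro allI impI)
    fix x y assume "y < (f ^^ Suc n) x"
    then obtain w where "w < (f ^^ n) x" "\<And>s. s > w \<Longrightarrow> y < f s"
      using \<open>left_cont f\<close> unfolding left_cont_def funpow.simps o_apply by blast
    moreover from this obtain w' where "w' < x" "\<And>x'. x' > w' \<Longrightarrow> w < (f ^^ n) x'"
      using Suc.IH[OF Suc.prems] unfolding left_cont_def by blast
    ultimately show "\<exists>w<x. \<forall>x'>w. y < (f ^^ Suc n) x'"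
      by (intro exI[of _ w']) auto
  qed
qed

lemma uniform_of_finite:
  fixes Q :: "real \<Rightarrow> 'a \<Rightarrow> bool"
  assumes "finite T" and ex: "\<And>\<delta>. \<delta> > 0 \<Longrightarrow> \<exists>t\<in>T. Q \<delta> t"
    and anti: "\<And>\<delta> \<delta>' t. \<delta> \<le> \<delta>' \<Longrightarrow> Q \<delta> t \<Longrightarrow> Q \<delta>' t"
  shows "\<exists>t\<in>T. \<forall>\<delta>>0. Q \<delta> t"
proof (rule ccontr)
  assume "\<not> ?thesis"
  then obtain e where e: "\<And>t. t \<in> T \<Longrightarrow> e t > 0 \<and> \<not> Q (e t) t" by metis
  define \<delta> where "\<delta> = Min (insert 1 (e ` T))"
  have "\<delta> > 0" using e assms(1) by (auto simp: \<delta>_def)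
  then obtain t where t: "t \<in> T" "Q \<delta> t" using ex by blast
  have "\<delta> \<le> e t" using assms(1) t by (auto simp: \<delta>_def)
  then show False using anti t e by blast
qed

context minimal_lift_group begin

text \<open>
  The farthest right end \<open>g v\<close> that a translate of the interval from \<open>u\<close> to \<open>v\<close> can reach while starting
  to the left of the first point of \<open>K\<close> after \<open>x\<close>. Minimality guarantees translates
  around points of \<open>K\<close> only, so that translates starting to the left of \<open>x\<close> itself might all end before \<open>x\<close> when \<open>x\<close>
  lies in a gap of \<open>K\<close>.
\<close>

definition jump :: "real \<Rightarrow> real \<Rightarrow> real \<Rightarrow> real" where
  "jump u v x = Sup {g v | g. g \<in> L \<and> (\<forall>z\<in>K. x \<le> z \<longrightarrow> g u < z)}"

context
  fixes p u v :: real
  assumes p: "p \<in> K" and uv: "u < p" "p < v"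
begin

lemma translate_around:
  assumes "k \<in> K" shows "\<exists>g\<in>L. g u < k \<and> k < g v"
proof -
  have "p \<in> {u<..<v} \<inter> K" using p uv by simp
  then obtain h where h: "h \<in> L" "h k \<in> {u<..<v}"
    using dense_K[OF assms, of "{u<..<v}"] open_greaterThanLessThan by blast
  obtain g where g: "g \<in> L" "\<And>x. g (h x) = x" using inverse[OF h(1)] by blast
  have "g u < g (h k)" "g (h k) < g v" using h less_iff[OF g(1)] by auto
  then show ?thesis using g by auto
qed

lemma less_jump_iff: "y < jump u v x \<longleftrightarrow> (\<exists>g\<in>L. (\<forall>z\<in>K. x \<le> z \<longrightarrow> g u < z) \<and> y < g v)"
  and less_jump: "x < jump u v x"
proof -
  let ?S = "{g v | g. g \<in> L \<and> (\<forall>z\<in>K. x \<le> z \<longrightarrow> g u < z)}"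
  \<comment> \<open>the first point of \<open>K\<close> from \<open>x\<close> on, which some translate covers by minimality\<close>
  define k where "k = Inf (K \<inter> {x..})"
  have k: "k \<in> K \<inter> {x..}" unfolding k_def
    using K_unbounded[of x] closed_K by (intro closed_contains_Inf) (auto intro: closed_Int)
  have k_le: "k \<le> z" if "z \<in> K" "x \<le> z" for z
    unfolding k_def using that by (intro cInf_lower) auto
  obtain g where g: "g \<in> L" "g u < k" "k < g v" using translate_around k by blast
  have gS: "g v \<in> ?S" using g(1,2) k_le by (fastforce intro: less_le_trans)
  obtain n :: nat where "(v - u) / P < of_nat n" using reals_Archimedean2 by blast
  then have n: "v \<le> u + of_int (int n) * P" using P_pos by (simp add: field_simps)
  have bdd: "bdd_above ?S"
  proof (rule bdd_aboveI)
    fix s assume "s \<in> ?S"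
    then obtain h where h: "s = h v" "h \<in> L" "h u < k" using k by auto
    have "h v \<le> h (u + of_int (int n) * P)" using le_iff[OF h(2)] n by blast
    also have "\<dots> = h u + of_int (int n) * P" by (rule periodic_int[OF h(2)])
    finally show "s \<le> k + of_int (int n) * P" using h by linarith
  qed
  show "y < jump u v x \<longleftrightarrow> (\<exists>g\<in>L. (\<forall>z\<in>K. x \<le> z \<longrightarrow> g u < z) \<and> y < g v)"
    unfolding jump_def using less_cSup_iff[of ?S y] bdd gS by blast
  have "g v \<le> jump u v x" unfolding jump_def by (rule cSup_upper[OF gS bdd])
  then show "x < jump u v x" using g(3) k by auto
qed

lemma jump_left_cont: "left_cont (jump u v)"
  unfolding left_cont_def
proof (intro allI impI)
  fix x y assume "y < jump u v x"
  then obtain g where g: "g \<in> L" "\<And>z. z \<in> K \<Longrightarrow> x \<le> z \<Longrightarrow> g u < z" "y < g v"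
    using less_jump_iff by blast
  define w where "w = Sup (K \<inter> {..g u})"
  have ne: "K \<inter> {..g u} \<noteq> {}" using K_unbounded[of "g u - P"] by auto
  have "w \<in> K \<inter> {..g u}" unfolding w_def
    using ne closed_K by (intro closed_contains_Sup) (auto intro: closed_Int)
  then have "w < x" using g(2)[of w] by force
  moreover have "y < jump u v x'" if "x' > w" for x'
  proof -
    have "g u < z" if "z \<in> K" "x' \<le> z" for z
    proof (rule ccontr)
      assume "\<not> g u < z"
      then have "z \<le> w" unfolding w_def using that by (intro cSup_upper) auto
      then show False using that \<open>x' > w\<close> by simp
    qed
    then have "\<exists>g\<in>L. (\<forall>z\<in>K. x' \<le> z \<longrightarrow> g u < z) \<and> y < g v" using g by blast
    then show ?thesis by (rule iffD2[OF less_jump_iff])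
  qed
  ultimately show "\<exists>w<x. \<forall>x'>w. y < jump u v x'" by blast
qed

lemma jump_commute_le:
  assumes h: "h \<in> L" shows "h (jump u v x) \<le> jump u v (h x)"
proof (rule ccontr)
  assume "\<not> ?thesis"
  then have less: "jump u v (h x) < h (jump u v x)" by simp
  obtain k where k: "k \<in> L" "\<And>x. k (h x) = x" "\<And>x. h (k x) = x" using inverse[OF h] by auto
  have "k (jump u v (h x)) < jump u v x" using less less_iff[OF k(1)] k(2) by metis
  then obtain g where g: "g \<in> L" "\<And>z. z \<in> K \<Longrightarrow> x \<le> z \<Longrightarrow> g u < z" "k (jump u v (h x)) < g v"
    using less_jump_iff by blast
  have "jump u v (h x) < h (g v)" using g(3) less_iff[OF h] k(3) by metis
  moreover have "h (g u) < z" if z: "z \<in> K" "h x \<le> z" for z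
  proof -
    have "x \<le> k z" using z(2) le_iff[OF k(1)] k(2) by metis
    then have "g u < k z" using g(2) inv_K[OF k(1) z(1)] by blast
    then show ?thesis using less_iff[OF h] k(3) by metis
  qed
  ultimately have "\<exists>g\<in>L. (\<forall>z\<in>K. h x \<le> z \<longrightarrow> g u < z) \<and> jump u v (h x) < g v"
    using comp[OF h g(1)] by (intro bexI[of _ "\<lambda>t. h (g t)"]) auto
  then have "jump u v (h x) < jump u v (h x)" by (rule iffD2[OF less_jump_iff])
  then show False by simp
qed

lemma stepping_jump: "stepping (jump u v)"
proof -
  have "mono (jump u v)"
  proof (rule monoI, rule ccontr)
    fix x x' :: real assume "x \<le> x'" and "\<not> jump u v x \<le> jump u v x'"
    then have "jump u v x' < jump u v x" by simp
    then obtain g where g: "g \<in> L" "\<And>z. z \<in> K \<Longrightarrow> x \<le> z \<Longrightarrow> g u < z" "jump u v x' < g v"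
      using less_jump_iff by blast
    then have "\<exists>g\<in>L. (\<forall>z\<in>K. x' \<le> z \<longrightarrow> g u < z) \<and> jump u v x' < g v"
      using \<open>x \<le> x'\<close> by (meson order_trans)
    then have "jump u v x' < jump u v x'" by (rule iffD2[OF less_jump_iff])
    then show False by simp
  qed
  moreover have "jump u v (h x) = h (jump u v x)" if h: "h \<in> L" for h x
  proof (rule antisym)
    obtain k where k: "k \<in> L" "\<And>x. k (h x) = x" "\<And>x. h (k x) = x" using inverse[OF h] by auto
    have "k (jump u v (h x)) \<le> jump u v x" using jump_commute_le[OF k(1), of "h x"] k(2) by simp
    then show "jump u v (h x) \<le> h (jump u v x)" using le_iff[OF h] k(3) by metis
  qed (rule jump_commute_le[OF h])
  moreover have "\<exists>n. y < (jump u v ^^ n) x" for x y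
  proof (rule ccontr)
    assume "\<not> ?thesis"
    then have bdd: "bdd_above (range (\<lambda>n. (jump u v ^^ n) x))" by (auto simp: not_less intro!: bdd_aboveI)
    define l where "l = (SUP n. (jump u v ^^ n) x)"
    obtain w where w: "w < l" "\<And>x'. x' > w \<Longrightarrow> l < jump u v x'"
      using less_jump[of l] jump_left_cont unfolding left_cont_def by blast
    then obtain n where "w < (jump u v ^^ n) x" unfolding l_def using less_cSUP_iff[OF _ bdd] by auto
    then have "l < (jump u v ^^ Suc n) x" using w by simp
    moreover have "(jump u v ^^ Suc n) x \<le> l" unfolding l_def by (rule cSUP_upper[OF _ bdd]) simp
    ultimately show False by simp
  qed
  ultimately show ?thesis using less_jump unfolding stepping_def by blast
qed

end

text \<open>
  For \<open>\<theta> = jump (p - \<delta>) (p + \<delta>)\<close> the first \<open>N\<close> steps cover a period, and the points of \<open>K\<close> inside one step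
  lie in a single translate of the interval. Among \<open>2 * N + 1\<close> points of \<open>K\<close>, three fall into the same
  step, hence some element of \<open>L\<close> brings all three within \<open>\<delta>\<close> of \<open>p\<close>. As \<open>N\<close> does not depend on \<open>\<delta>\<close>, the same three points
  can be used for every \<open>\<delta>\<close>; the middle one puts a point of \<open>K\<close> inside the contractible interval.
\<close>

lemma contractible_interval:
  assumes p: "p \<in> K" and N: "\<And>\<theta>. stepping \<theta> \<Longrightarrow> P < (\<theta> ^^ N) 0"
  obtains s1 s2 s3 where "s2 \<in> K" "s1 < s2" "s2 < s3"
    "\<And>\<delta>. \<delta> > 0 \<Longrightarrow> \<exists>g\<in>L. p - \<delta> < g s1 \<and> g s3 < p + \<delta>"
proof -
  obtain S where S: "finite S" "card S = 2 * N + 1" "S \<subseteq> K \<inter> {0..<P}"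
    using infinite_arbitrarily_large[OF infinite_K] by blast
  define Q where "Q \<delta> = (\<lambda>(s1, s2, s3). s1 < s2 \<and> s2 < s3 \<and> (\<exists>g\<in>L. p - \<delta> < g s1 \<and> g s3 < p + \<delta>))" for \<delta>
  have "\<exists>t\<in>S \<times> S \<times> S. \<forall>\<delta>>0. Q \<delta> t"
  proof (rule uniform_of_finite)
    fix \<delta> :: real assume "\<delta> > 0"
    then have \<delta>: "p - \<delta> < p" "p < p + \<delta>" by auto
    define \<theta> where "\<theta> = jump (p - \<delta>) (p + \<delta>)"
    have \<theta>: "stepping \<theta>" unfolding \<theta>_def by (rule stepping_jump[OF p \<delta>])
    have idx: "steps \<theta> 0 ` S \<subseteq> {..<N}"
    proof
      fix i assume "i \<in> steps \<theta> 0 ` S"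
      then obtain s where "s \<in> S" "i = steps \<theta> 0 s" by auto
      then show "i \<in> {..<N}" using steps_lessI[OF \<theta>, of 0 s N] N[OF \<theta>] S(3) by force
    qed
    have "\<exists>i. card {s\<in>S. steps \<theta> 0 s = i} \<ge> 3"
    proof (rule ccontr)
      assume c: "\<not> ?thesis"
      have "S = (\<Union>i<N. {s\<in>S. steps \<theta> 0 s = i})" using idx by auto
      then have "card S \<le> (\<Sum>i<N. card {s\<in>S. steps \<theta> 0 s = i})" using card_UN_le by (metis finite_lessThan)
      also have "\<dots> \<le> (\<Sum>i<N. 2)" using c by (intro sum_mono) (simp add: not_le less_Suc_eq_le numeral_3_eq_3 numeral_2_eq_2)
      finally show False using S(2) by simp
    qed
    then obtain i where i: "card {s\<in>S. steps \<theta> 0 s = i} \<ge> 3" ..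
    define T where "T = {s\<in>S. steps \<theta> 0 s = i}"
    have T: "finite T" "card T \<ge> 3" using S(1) i by (simp_all add: T_def)
    then have "T \<noteq> {}" by auto
    have "\<not> T \<subseteq> {Min T, Max T}"
      using T(2) card_mono[of "{Min T, Max T}" T] card_insert_le_m1[of 2 "{Max T}" "Min T"] by fastforce
    then obtain s2 where s2: "s2 \<in> T" "s2 \<noteq> Min T" "s2 \<noteq> Max T" by auto
    have lt: "Min T < s2" "s2 < Max T" using T s2 by (simp_all add: order_less_le)
    have mT: "Min T \<in> T" "Max T \<in> T" using T(1) \<open>T \<noteq> {}\<close> by simp_all
    have "Max T < (\<theta> ^^ Suc i) 0" using less_steps[OF \<theta>, of "Max T" 0] mT(2) by (simp add: T_def)
    then have "Max T < jump (p - \<delta>) (p + \<delta>) ((\<theta> ^^ i) 0)" by (simp add: \<theta>_def)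
    then obtain g where g: "g \<in> L" "\<And>z. z \<in> K \<Longrightarrow> (\<theta> ^^ i) 0 \<le> z \<Longrightarrow> g (p - \<delta>) < z" "Max T < g (p + \<delta>)"
      using less_jump_iff[OF p \<delta>] by blast
    have "(\<theta> ^^ i) 0 \<le> Min T" using steps_le[OF \<theta>, of 0 "Min T"] mT(1) S(3) by (auto simp: T_def)
    then have g1: "g (p - \<delta>) < Min T" using g(2) mT(1) S(3) by (auto simp: T_def)
    obtain h where h: "h \<in> L" "\<And>x. h (g x) = x" using inverse[OF g(1)] by blast
    have "p - \<delta> < h (Min T)" "h (Max T) < p + \<delta>"
      using g1 g(3) less_iff[OF h(1)] h(2) by metis+
    then have "Q \<delta> (Min T, s2, Max T)" using h(1) lt by (auto simp: Q_def)
    moreover have "(Min T, s2, Max T) \<in> S \<times> S \<times> S" using mT s2 by (auto simp: T_def)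
    ultimately show "\<exists>t\<in>S \<times> S \<times> S. Q \<delta> t" by blast
  next
    fix \<delta> \<delta>' :: real and t assume le: "\<delta> \<le> \<delta>'" and "Q \<delta> t"
    then obtain g where g: "g \<in> L" "p - \<delta> < g (fst t)" "g (snd (snd t)) < p + \<delta>"
      by (auto simp: Q_def split: prod.splits)
    then have "p - \<delta>' < g (fst t)" "g (snd (snd t)) < p + \<delta>'" using le by linarith+
    then show "Q \<delta>' t" using \<open>Q \<delta> t\<close> g(1) by (auto simp: Q_def split: prod.splits)
  qed (use S(1) in simp)
  then obtain s1 s2 s3 where s: "s2 \<in> S" "\<And>\<delta>. \<delta> > 0 \<Longrightarrow> Q \<delta> (s1, s2, s3)" by blast
  have "s1 < s2" "s2 < s3" using s(2)[of 1] by (auto simp: Q_def)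
  moreover have "\<exists>g\<in>L. p - \<delta> < g s1 \<and> g s3 < p + \<delta>" if "\<delta> > 0" for \<delta>
    using s(2)[OF that] by (simp add: Q_def)
  ultimately show ?thesis using that s(1) S(3) by blast
qed

text \<open>
  Let \<open>\<theta>\<close> be the jump map of a contractible interval around \<open>p\<close>. By its definition, \<open>x0\<close> and any \<open>y < \<theta> x0\<close>
  lie in a translate of that interval, so some \<open>h\<close> in \<open>L\<close> sends the interval from \<open>x0\<close> to \<open>y\<close> just to the
  left of \<open>p\<close>. Because \<open>h\<close> commutes with \<open>\<theta>\<close>, it also sends each interval from \<open>\<theta>\<^sup>i x0\<close> to \<open>\<theta>\<^sup>i y\<close> just to the left of
  \<open>\<theta>\<^sup>i p\<close>, by left-continuity; and as \<open>y\<close> increases to \<open>\<theta> x0\<close> these intervals fill a period up to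
  small gaps to the left of the points \<open>\<theta>\<^sup>i\<^sup>+\<^sup>1 x0\<close>. Left neighbourhoods of \<open>p\<close> are needed because \<open>\<theta>\<close> may
  jump at \<open>p\<close>; this is why \<open>p\<close> is chosen as an accumulation point of \<open>K\<close> from the left.
\<close>

lemma finite_concentration:
  assumes N: "\<And>\<theta>. stepping \<theta> \<Longrightarrow> P < (\<theta> ^^ N) 0"
  obtains A B where "finite A" "finite B" "A \<noteq> {}"
    "\<And>\<epsilon>. \<epsilon> > 0 \<Longrightarrow> \<exists>h\<in>L. \<forall>x. \<not> near B \<epsilon> x \<longrightarrow> near A \<epsilon> (h x)"
proof -
  obtain p where p: "p \<in> K" "\<And>\<delta>. \<delta> > 0 \<Longrightarrow> \<exists>z\<in>K. p - \<delta> < z \<and> z < p"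
    using left_accumulation_point by blast
  obtain s1 s2 s3 where s: "s2 \<in> K" "s1 < s2" "s2 < s3"
    "\<And>\<delta>. \<delta> > 0 \<Longrightarrow> \<exists>g\<in>L. p - \<delta> < g s1 \<and> g s3 < p + \<delta>"
    using contractible_interval[OF p(1) N] by metis
  have "s2 \<in> {s1<..<s3} \<inter> K" using s by simp
  then obtain c where c: "c \<in> L" "c p \<in> {s1<..<s3}"
    using dense_K[OF p(1), of "{s1<..<s3}"] open_greaterThanLessThan by blast
  obtain c' where c': "c' \<in> L" "\<And>x. c' (c x) = x" "\<And>x. c (c' x) = x" using inverse[OF c(1)] by auto
  define u v where "u = c' s1" and "v = c' s3"
  have "c' s1 < c' (c p)" "c' (c p) < c' s3" using c(2) less_iff[OF c'(1)] by auto
  then have uv: "u < p" "p < v" by (simp_all add: u_def v_def c'(2))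
  have left: "\<exists>g\<in>L. p - \<delta> < g u \<and> g v < p" if "\<delta> > 0" for \<delta>
  proof -
    obtain z where "z \<in> K" "p - \<delta> < z" "z < p" using p(2)[OF \<open>\<delta> > 0\<close>] by blast
    then have "z \<in> {p - \<delta><..<p} \<inter> K" by simp
    then obtain h where h: "h \<in> L" "h p \<in> {p - \<delta><..<p}"
      using dense_K[OF p(1), of "{p - \<delta><..<p}"] open_greaterThanLessThan by blast
    have "open (h -` {p - \<delta><..<p})" using cont[OF h(1)] by (intro open_vimage) auto
    moreover have "p \<in> h -` {p - \<delta><..<p}" using h(2) by simp
    ultimately have "\<exists>\<delta>'>0. \<forall>y. dist y p < \<delta>' \<longrightarrow> y \<in> h -` {p - \<delta><..<p}"
      unfolding open_dist by blast
    then obtain \<delta>' where \<delta>': "\<delta>' > 0" "\<And>y. dist y p < \<delta>' \<Longrightarrow> h y \<in> {p - \<delta><..<p}"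
      unfolding vimage_eq by blast
    obtain g where g: "g \<in> L" "p - \<delta>' < g s1" "g s3 < p + \<delta>'" using s(4)[OF \<delta>'(1)] by blast
    have "g s1 < g s3" using s less_iff[OF g(1)] by simp
    then have "dist (g s1) p < \<delta>'" "dist (g s3) p < \<delta>'" using g by (auto simp: dist_real_def)
    then have "h (g s1) \<in> {p - \<delta><..<p}" "h (g s3) \<in> {p - \<delta><..<p}" using \<delta>'(2) by blast+
    then show ?thesis using comp[OF h(1) comp[OF g(1) c(1)]]
      by (intro bexI[of _ "\<lambda>x. h (g (c x))"]) (auto simp: u_def v_def c'(3))
  qed
  define \<theta> where "\<theta> = jump u v"
  have \<theta>: "stepping \<theta>" unfolding \<theta>_def by (rule stepping_jump[OF p(1) uv])
  have lc: "left_cont (\<theta> ^^ i)" for i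
    unfolding \<theta>_def by (rule left_cont_funpow[OF jump_left_cont[OF p(1) uv]])
  obtain x0 where x0: "x0 \<in> K" using ne_K by auto
  obtain k where k: "x0 + P < (\<theta> ^^ k) x0" using \<theta> unfolding stepping_def by blast
  define A where "A = (\<lambda>i. (\<theta> ^^ i) p) ` {..<k}"
  define B where "B = (\<lambda>i. (\<theta> ^^ Suc i) x0) ` {..<k}"
  have "\<exists>h\<in>L. \<forall>x. \<not> near B \<epsilon> x \<longrightarrow> near A \<epsilon> (h x)" if \<epsilon>: "\<epsilon> > 0" for \<epsilon>
  proof -
    have "\<exists>w<\<theta> x0. \<forall>y>w. (\<theta> ^^ i) (\<theta> x0) - \<epsilon> < (\<theta> ^^ i) y" for i
      using lc[of i] \<epsilon> unfolding left_cont_def by simp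
    then obtain w where w: "\<And>i. w i < \<theta> x0" "\<And>i y. y > w i \<Longrightarrow> (\<theta> ^^ i) (\<theta> x0) - \<epsilon> < (\<theta> ^^ i) y"
      by metis
    have "\<exists>w<p. \<forall>y>w. (\<theta> ^^ i) p - \<epsilon> < (\<theta> ^^ i) y" for i
      using lc[of i] \<epsilon> unfolding left_cont_def by simp
    then obtain q where q: "\<And>i. q i < p" "\<And>i y. y > q i \<Longrightarrow> (\<theta> ^^ i) p - \<epsilon> < (\<theta> ^^ i) y"
      by metis
    define w1 where "w1 = Max (w ` {..k})"
    define q1 where "q1 = Max (q ` {..k})"
    have "w1 \<in> w ` {..k}" "q1 \<in> q ` {..k}" unfolding w1_def q1_def by (intro Max_in; simp)+
    then have "w1 < \<theta> x0" "q1 < p" using w(1) q(1) by auto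
    then obtain y where y: "w1 < y" "y < \<theta> x0" using dense by blast
    have wy: "(\<theta> ^^ Suc i) x0 - \<epsilon> < (\<theta> ^^ i) y" if "i < k" for i
    proof -
      have "w i \<le> w1" using that unfolding w1_def by (intro Max_ge) auto
      then show ?thesis using w(2)[of i y] y by (simp add: funpow_swap1)
    qed
    have qy: "(\<theta> ^^ i) p - \<epsilon> < (\<theta> ^^ i) t" if "i < k" "q1 < t" for i t
    proof -
      have "q i \<le> q1" using that unfolding q1_def by (intro Max_ge) auto
      then show ?thesis using q(2)[of i t] that by simp
    qed
    obtain g where g: "g \<in> L" "\<And>z. z \<in> K \<Longrightarrow> x0 \<le> z \<Longrightarrow> g u < z" "y < g v"
      using y(2) less_jump_iff[OF p(1) uv] unfolding \<theta>_def by blast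
    obtain f where f: "f \<in> L" "p - (p - q1) < f u" "f v < p" using left[of "p - q1"] \<open>q1 < p\<close> by auto
    obtain g' where g': "g' \<in> L" "\<And>x. g' (g x) = x" using inverse[OF g(1)] by blast
    define h where "h x = f (g' x)" for x
    have h: "h \<in> L" unfolding h_def by (rule comp[OF f(1) g'(1)])
    have "g u < x0" using g(2)[OF x0] by simp
    then have "u < g' x0" "g' y < v" using g(3) g'(2) less_iff[OF g'(1)] by metis+
    then have "f u < f (g' x0)" "f (g' y) < f v" using less_iff[OF f(1)] by auto
    then have hx: "q1 < h x0" "h y < p" using f(2,3) unfolding h_def by linarith+
    have "near A \<epsilon> (h x)" if nB: "\<not> near B \<epsilon> x" for x
    proof -
      obtain n :: int where n: "x0 \<le> x + of_int n * P" "x + of_int n * P < x0 + P" using reduce by blast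
      define x' where "x' = x + of_int n * P"
      define i where "i = steps \<theta> x0 x'"
      have i: "(\<theta> ^^ i) x0 \<le> x'" "x' < (\<theta> ^^ Suc i) x0" "i < k"
        unfolding i_def using steps_le[OF \<theta>] less_steps[OF \<theta>] steps_lessI[OF \<theta>] n k by (auto simp: x'_def)
      have "\<epsilon> \<le> \<bar>x - ((\<theta> ^^ Suc i) x0 + of_int (-n) * P)\<bar>"
        using nB i(3) unfolding near_def B_def by (meson imageI lessThan_iff not_less)
      then have "x' \<le> (\<theta> ^^ Suc i) x0 - \<epsilon>" using i(2) by (simp add: x'_def abs_if split: if_splits)
      then have x'y: "x' \<le> (\<theta> ^^ i) y" using wy[OF i(3)] by simp
      have "h ((\<theta> ^^ i) x0) \<le> h x'" "h x' \<le> h ((\<theta> ^^ i) y)" using i(1) x'y le_iff[OF h] by auto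
      then have "(\<theta> ^^ i) (h x0) \<le> h x'" "h x' \<le> (\<theta> ^^ i) (h y)" by (simp_all add: iterate_commute[OF \<theta> h])
      moreover have "(\<theta> ^^ i) (h y) \<le> (\<theta> ^^ i) p" using iterate_mono[OF \<theta>] hx by simp
      moreover have "(\<theta> ^^ i) p - \<epsilon> < (\<theta> ^^ i) (h x0)" using qy[OF i(3)] hx by blast
      moreover have "h x' = h x + of_int n * P" unfolding x'_def by (rule periodic_int[OF h])
      ultimately have "\<bar>h x - ((\<theta> ^^ i) p + of_int (-n) * P)\<bar> < \<epsilon>" using \<epsilon> by (simp add: abs_if)
      then show ?thesis unfolding near_def A_def using i(3) by blast
    qed
    then show ?thesis using h by blast
  qed
  moreover have "k \<noteq> 0" using k P_pos by (cases k) auto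
  ultimately show ?thesis using that[of A B] by (auto simp: A_def B_def)
qed

end

section \<open>Ping-pong pairs\<close>

context lift_group begin

lemma near_mono: "near A \<epsilon> x \<Longrightarrow> \<epsilon> \<le> \<delta> \<Longrightarrow> near A \<delta> x"
  unfolding near_def by (meson less_le_trans)

lemma near_move: "near A \<epsilon> x \<Longrightarrow> \<bar>y - x\<bar> \<le> \<delta> \<Longrightarrow> near A (\<epsilon> + \<delta>) y"
proof -
  assume "near A \<epsilon> x" and le: "\<bar>y - x\<bar> \<le> \<delta>"
  then obtain a and n :: int where an: "a \<in> A" "\<bar>x - (a + of_int n * P)\<bar> < \<epsilon>" by (auto simp: near_def)
  have "\<bar>y - (a + of_int n * P)\<bar> < \<epsilon> + \<delta>" using an(2) le by linarith
  then show ?thesis unfolding near_def using an(1) by blast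
qed

lemma near_periodic_int: "near A \<epsilon> (x + of_int m * P) \<longleftrightarrow> near A \<epsilon> x"
proof -
  have imp: "near A \<epsilon> (x + of_int m * P)" if near: "near A \<epsilon> x" for x and m :: int
  proof -
    obtain a and n :: int where an: "a \<in> A" "\<bar>x - (a + of_int n * P)\<bar> < \<epsilon>" using near by (auto simp: near_def)
    have "x + of_int m * P - (a + of_int (n + m) * P) = x - (a + of_int n * P)" by (simp add: algebra_simps)
    then show ?thesis using an unfolding near_def by metis
  qed
  show ?thesis using imp[of x m] imp[of "x + of_int m * P" "- m"] by auto
qed

lemma open_near: "open {x. near A \<epsilon> x}"
proof -
  have "{x. near A \<epsilon> x} = (\<Union>a\<in>A. \<Union>n::int. ball (a + of_int n * P) \<epsilon>)"
    by (simp add: set_eq_iff near_def dist_real_def abs_minus_commute)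
  then show ?thesis by auto
qed

lemma near_image:
  assumes "finite X" "h \<in> L" "0 < \<epsilon>"
  shows "\<exists>\<delta>>0. \<forall>x. near X \<delta> x \<longrightarrow> near (h ` X) \<epsilon> (h x)"
proof -
  have "\<exists>d>0. \<forall>x. dist x a < d \<longrightarrow> dist (h x) (h a) < \<epsilon>" for a
    using cont[OF assms(2)] assms(3) unfolding continuous_on_iff by auto
  then obtain d where d: "\<And>a. d a > 0" "\<And>a x. dist x a < d a \<Longrightarrow> dist (h x) (h a) < \<epsilon>" by metis
  define \<delta> where "\<delta> = Min (insert 1 (d ` X))"
  have "\<delta> > 0" using d(1) assms(1) by (auto simp: \<delta>_def)
  moreover have "near (h ` X) \<epsilon> (h x)" if near: "near X \<delta> x" for x
  proof -
    obtain a and n :: int where an: "a \<in> X" "\<bar>x - (a + of_int n * P)\<bar> < \<delta>" using near by (auto simp: near_def)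
    have "\<delta> \<le> d a" using assms(1) an by (auto simp: \<delta>_def)
    then have "dist (x + of_int (-n) * P) a < d a" using an(2) by (simp add: dist_real_def algebra_simps)
    then have "dist (h x + of_int (-n) * P) (h a) < \<epsilon>" using d(2) periodic_int[OF assms(2)] by metis
    then have "\<bar>h x - (h a + of_int n * P)\<bar> < \<epsilon>" by (simp add: dist_real_def algebra_simps)
    then show ?thesis using an(1) unfolding near_def by blast
  qed
  ultimately show ?thesis by blast
qed

definition disjoint_mod :: "real set \<Rightarrow> real set \<Rightarrow> bool" where
  "disjoint_mod X Y \<longleftrightarrow> (\<forall>x\<in>X. \<forall>y\<in>Y. \<forall>n::int. x \<noteq> y + of_int n * P)"

lemma disjoint_mod_separated:
  assumes "finite X" "finite Y" "disjoint_mod X Y"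
  obtains \<epsilon> where "\<epsilon> > 0" "\<And>z. \<not> (near X \<epsilon> z \<and> near Y \<epsilon> z)"
proof -
  have "\<exists>e>0. \<forall>n::int. e \<le> \<bar>x - (y + of_int n * P)\<bar>" if xy: "x \<in> X" "y \<in> Y" for x y
  proof -
    obtain m :: int where m: "y \<le> x + of_int m * P" "x + of_int m * P < y + P" using reduce by blast
    define r where "r = x + of_int m * P - y"
    have "r \<noteq> 0"
    proof
      assume "r = 0"
      then have "x = y + of_int (-m) * P" by (simp add: r_def)
      then show False using assms(3) xy unfolding disjoint_mod_def by blast
    qed
    then have r: "0 < r" "r < P" using m by (auto simp: r_def)
    have "min r (P - r) \<le> \<bar>x - (y + of_int n * P)\<bar>" for n :: int
    proof -
      have eq: "x - (y + of_int n * P) = r - of_int (n + m) * P" by (simp add: r_def algebra_simps)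
      show ?thesis
      proof (cases "n + m \<le> 0")
        case True
        then have "of_int (n + m) * P \<le> 0" using P_pos by (simp add: mult_nonpos_nonneg)
        then show ?thesis unfolding eq using r by linarith
      next
        case False
        then have "1 * P \<le> of_int (n + m) * P" using P_pos by (intro mult_right_mono) linarith+
        then show ?thesis unfolding eq using r by linarith
      qed
    qed
    then show ?thesis using r by (intro exI[of _ "min r (P - r)"]) auto
  qed
  then obtain e where e: "\<And>x y. x \<in> X \<Longrightarrow> y \<in> Y \<Longrightarrow> e x y > 0"
    "\<And>x y n. x \<in> X \<Longrightarrow> y \<in> Y \<Longrightarrow> e x y \<le> \<bar>x - (y + of_int n * P)\<bar>" by metis
  define E where "E = (\<lambda>(x, y). e x y) ` (X \<times> Y)"
  define \<epsilon> where "\<epsilon> = Min (insert 1 E) / 2"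
  have fin: "finite E" using assms by (simp add: E_def)
  have "\<epsilon> > 0" using fin e(1) by (auto simp: \<epsilon>_def E_def)
  moreover have False if nX: "near X \<epsilon> z" and nY: "near Y \<epsilon> z" for z
  proof -
    obtain x and n :: int where x: "x \<in> X" "\<bar>z - (x + of_int n * P)\<bar> < \<epsilon>" using nX by (auto simp: near_def)
    obtain y and m :: int where y: "y \<in> Y" "\<bar>z - (y + of_int m * P)\<bar> < \<epsilon>" using nY by (auto simp: near_def)
    have "\<bar>x - (y + of_int (m - n) * P)\<bar> < 2 * \<epsilon>" using x(2) y(2) by (simp add: algebra_simps)
    moreover have "e x y \<in> insert 1 E" using x(1) y(1) by (auto simp: E_def)
    then have "2 * \<epsilon> \<le> e x y" using Min_le[of "insert 1 E"] fin by (simp add: \<epsilon>_def)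
    ultimately show False using e(2)[OF x(1) y(1), of "m - n"] by linarith
  qed
  ultimately show ?thesis using that by blast
qed

definition residue :: "real \<Rightarrow> real" where
  "residue x = x - of_int \<lfloor>x / P\<rfloor> * P"

lemma residue_range: "residue x \<in> {0..<P}"
  using floor_divide_lower[OF P_pos, of x] floor_divide_upper[OF P_pos, of x]
  by (simp add: residue_def algebra_simps)

lemma residue_add [simp]: "residue (x + of_int n * P) = residue x"
proof -
  have "(x + of_int n * P) / P = x / P + of_int n" using P_pos by (simp add: field_simps)
  then have "\<lfloor>(x + of_int n * P) / P\<rfloor> = \<lfloor>x / P\<rfloor> + n" by simp
  then show ?thesis by (simp add: residue_def algebra_simps)
qed

lemma residue_id: "x \<in> {0..<P} \<Longrightarrow> residue x = x"
proof -
  assume x: "x \<in> {0..<P}"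
  then have "\<lfloor>x / P\<rfloor> = 0" using P_pos by (simp add: floor_eq_iff)
  then show ?thesis by (simp add: residue_def)
qed

lemma residue_apply: "g \<in> L \<Longrightarrow> residue (g (residue x)) = residue (g x)"
  using periodic_int[of g x "- \<lfloor>x / P\<rfloor>"] residue_add[of "g x" "- \<lfloor>x / P\<rfloor>"]
  by (simp add: residue_def[of x])

lemma move_off_mod:
  assumes inf: "\<And>x. infinite ((\<lambda>g. residue (g x)) ` L)" and fin: "finite X" "finite Y"
  obtains h where "h \<in> L" "disjoint_mod (h ` X) Y"
proof -
  define G where "G = (\<lambda>g x. residue (g x)) ` L"
  have "\<exists>g\<in>G. g ` (residue ` X) \<inter> residue ` Y = {}"
  proof (rule move_off_finite_set[where X = "{0..<P}"])
    show "G \<noteq> {}" using shift by (auto simp: G_def)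
    show "g x \<in> {0..<P}" if "g \<in> G" for g x using that residue_range by (auto simp: G_def)
    show "\<exists>k\<in>G. \<forall>x\<in>{0..<P}. k x = g (h x)" if gh: "g \<in> G" "h \<in> G" for g h
    proof -
      obtain g0 h0 where "g0 \<in> L" "h0 \<in> L" "g = (\<lambda>x. residue (g0 x))" "h = (\<lambda>x. residue (h0 x))"
        using gh by (auto simp: G_def)
      then show ?thesis unfolding G_def using comp[of g0 h0] residue_apply[of g0]
        by (intro bexI[of _ "\<lambda>x. residue (g0 (h0 x))"] imageI[of "\<lambda>x. g0 (h0 x)" L "\<lambda>g x. residue (g x)"]) auto
    qed
    show "\<exists>k\<in>G. \<forall>x\<in>{0..<P}. k (g x) = x \<and> g (k x) = x" if g: "g \<in> G" for g
    proof -
      obtain g0 where g0: "g0 \<in> L" "g = (\<lambda>x. residue (g0 x))" using g by (auto simp: G_def)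
      obtain k0 where "k0 \<in> L" "\<And>x. k0 (g0 x) = x" "\<And>x. g0 (k0 x) = x" using inverse[OF g0(1)] by auto
      then show ?thesis using g0 residue_apply residue_id unfolding G_def
        by (intro bexI[of _ "\<lambda>x. residue (k0 x)"]) auto
    qed
    show "infinite ((\<lambda>g. g a) ` G)" for a using inf[of a] by (simp add: G_def image_image)
    show "residue ` X \<subseteq> {0..<P}" "residue ` Y \<subseteq> {0..<P}" using residue_range by auto
  qed (use fin in auto)
  then obtain h where h: "h \<in> L" "\<And>x y. x \<in> X \<Longrightarrow> y \<in> Y \<Longrightarrow> residue (h x) \<noteq> residue y"
    unfolding G_def by (fastforce simp: residue_apply)
  have "disjoint_mod (h ` X) Y" unfolding disjoint_mod_def using h(2) residue_add by fastforce
  then show ?thesis using that h(1) by blast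
qed

lemma conjugate_concentration:
  assumes fin: "finite A" "finite B"
    and conc: "\<And>\<epsilon>. \<epsilon> > 0 \<Longrightarrow> \<exists>h\<in>L. \<forall>x. \<not> near B \<epsilon> x \<longrightarrow> near A \<epsilon> (h x)"
    and hk: "h \<in> L" "k \<in> L" and \<eta>: "\<eta> > 0"
  obtains f where "f \<in> L" "\<And>x. \<not> near (k ` B) \<eta> x \<Longrightarrow> near (h ` A) \<eta> (f x)"
proof -
  obtain a where a: "a > 0" "\<And>x. near A a x \<Longrightarrow> near (h ` A) \<eta> (h x)" using near_image[OF fin(1) hk(1) \<eta>] by blast
  obtain b where b: "b > 0" "\<And>x. near B b x \<Longrightarrow> near (k ` B) \<eta> (k x)" using near_image[OF fin(2) hk(2) \<eta>] by blast
  obtain k' where k': "k' \<in> L" "\<And>x. k (k' x) = x" using inverse[OF hk(2)] by blast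
  obtain g where g: "g \<in> L" "\<And>x. \<not> near B (min a b) x \<Longrightarrow> near A (min a b) (g x)"
    using conc[of "min a b"] a b by auto
  have "near (h ` A) \<eta> (h (g (k' x)))" if "\<not> near (k ` B) \<eta> x" for x
  proof -
    have "\<not> near B b (k' x)" using b(2)[of "k' x"] k'(2) that by auto
    then have "near A (min a b) (g (k' x))" using g(2) near_mono min.cobounded2 by blast
    then show ?thesis using a(2) near_mono min.cobounded1 by blast
  qed
  then show ?thesis using that comp[OF hk(1) comp[OF g(1) k'(1)]] by blast
qed

end

text \<open>
  The doubled radius in the separation conditions
  leaves room for an interval of length \<open>\<eta>\<close> around every point outside the larger neighbourhood of \<open>B c\<close>,
  on which the mean value theorem can be used.
\<close>

locale ping_pong = lift_group +
  fixes f :: "bool \<Rightarrow> real \<Rightarrow> real" and A B :: "bool \<Rightarrow> real set" and \<eta> :: real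
  assumes f_in: "f c \<in> L" and eta: "0 < \<eta>" "\<eta> \<le> P"
    and contract: "\<not> near (B c) \<eta> x \<Longrightarrow> near (A c) \<eta> (f c x)"
    and disj_A: "near (A c) (2 * \<eta>) x \<Longrightarrow> near (A d) (2 * \<eta>) x \<Longrightarrow> c = d"
    and disj_B: "near (B c) (2 * \<eta>) x \<Longrightarrow> near (B d) (2 * \<eta>) x \<Longrightarrow> c = d"
    and disj_AB: "near (A c) (2 * \<eta>) x \<Longrightarrow> \<not> near (B d) (2 * \<eta>) x"

text \<open>
  The composite \<open>h \<circ> g \<circ> k\<^sup>-\<^sup>1\<close> of a concentrating element \<open>g\<close> with elements \<open>h\<close> and \<open>k\<close> concentrates near \<open>h ` A\<close>
  off \<open>k ` B\<close>, so it suffices to move copies of \<open>A\<close> and \<open>B\<close> off each other one after the other, which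
  is possible because all orbits are infinite.
\<close>

lemma (in lift_group) ping_pong_exists:
  assumes inf: "\<And>x. infinite ((\<lambda>g. residue (g x)) ` L)" and fin: "finite A" "finite B"
    and conc: "\<And>\<epsilon>. \<epsilon> > 0 \<Longrightarrow> \<exists>h\<in>L. \<forall>x. \<not> near B \<epsilon> x \<longrightarrow> near A \<epsilon> (h x)"
    and ne: "A \<noteq> {}"
  obtains f A' B' \<eta> where "ping_pong L P f A' B' \<eta>" "\<And>c. A' c \<noteq> {}"
proof -
  obtain k1 where k1: "k1 \<in> L" "disjoint_mod (k1 ` B) A" using move_off_mod[OF inf fin(2,1)] by blast
  obtain h2 where h2: "h2 \<in> L" "disjoint_mod (h2 ` A) (A \<union> k1 ` B)"
    using move_off_mod[OF inf fin(1), of "A \<union> k1 ` B"] fin by blast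
  obtain k2 where k2: "k2 \<in> L" "disjoint_mod (k2 ` B) (A \<union> k1 ` B \<union> h2 ` A)"
    using move_off_mod[OF inf fin(2), of "A \<union> k1 ` B \<union> h2 ` A"] fin by blast
  define h where "h c = (if c then h2 else (\<lambda>x. x))" for c
  define k where "k c = (if c then k2 else k1)" for c
  have hk: "h c \<in> L" "k c \<in> L" for c using h2 k1 k2 id_in by (auto simp: h_def k_def)
  obtain e1 where e1: "e1 > 0" "\<And>z. \<not> (near (k1 ` B) e1 z \<and> near A e1 z)"
    using disjoint_mod_separated[OF _ _ k1(2)] fin by blast
  obtain e2 where e2: "e2 > 0" "\<And>z. \<not> (near (h2 ` A) e2 z \<and> near (A \<union> k1 ` B) e2 z)"
    using disjoint_mod_separated[OF _ _ h2(2)] fin by blast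
  obtain e3 where e3: "e3 > 0" "\<And>z. \<not> (near (k2 ` B) e3 z \<and> near (A \<union> k1 ` B \<union> h2 ` A) e3 z)"
    using disjoint_mod_separated[OF _ _ k2(2)] fin by blast
  define \<eta> where "\<eta> = Min {e1, e2, e3, P} / 2"
  have le: "2 * \<eta> \<le> e1" "2 * \<eta> \<le> e2" "2 * \<eta> \<le> e3" and eta: "0 < \<eta>" "\<eta> \<le> P"
    using e1(1) e2(1) e3(1) P_pos by (auto simp: \<eta>_def)
  have "\<exists>f\<in>L. \<forall>x. \<not> near (k c ` B) \<eta> x \<longrightarrow> near (h c ` A) \<eta> (f x)" for c
    using conjugate_concentration[OF fin conc hk eta(1)] by metis
  then obtain f where f: "\<And>c. f c \<in> L" "\<And>c x. \<not> near (k c ` B) \<eta> x \<Longrightarrow> near (h c ` A) \<eta> (f c x)" by metis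
  have un: "near (X \<union> Y) e z \<longleftrightarrow> near X e z \<or> near Y e z" for X Y e z by (auto simp: near_def)
  have d1: "\<not> (near (k1 ` B) (2 * \<eta>) z \<and> near A (2 * \<eta>) z)" for z
    using e1(2)[of z] near_mono[OF _ le(1)] by blast
  have d2: "\<not> (near (h2 ` A) (2 * \<eta>) z \<and> near (A \<union> k1 ` B) (2 * \<eta>) z)" for z
    using e2(2)[of z] near_mono[OF _ le(2)] by blast
  have d3: "\<not> (near (k2 ` B) (2 * \<eta>) z \<and> near (A \<union> k1 ` B \<union> h2 ` A) (2 * \<eta>) z)" for z
    using e3(2)[of z] near_mono[OF _ le(3)] by blast
  have "ping_pong L P f (\<lambda>c. h c ` A) (\<lambda>c. k c ` B) \<eta>"
  proof
    show "c = d" if "near (h c ` A) (2 * \<eta>) x" "near (h d ` A) (2 * \<eta>) x" for c d x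
      using that d2[of x] by (cases c; cases d) (auto simp: h_def un)
    show "c = d" if "near (k c ` B) (2 * \<eta>) x" "near (k d ` B) (2 * \<eta>) x" for c d x
      using that d3[of x] by (cases c; cases d) (auto simp: k_def un)
    show "\<not> near (k d ` B) (2 * \<eta>) x" if "near (h c ` A) (2 * \<eta>) x" for c d x
      using that d1[of x] d2[of x] d3[of x] by (cases c; cases d) (auto simp: h_def k_def un)
  qed (use f eta in auto)
  then show ?thesis using that ne by blast
qed

section \<open>Words with small images\<close>

locale C1_ping_pong = ping_pong +
  assumes has_deriv: "g \<in> L \<Longrightarrow> (g has_real_derivative deriv g x) (at x)"
    and cont_deriv: "g \<in> L \<Longrightarrow> continuous_on UNIV (deriv g)"
    and deriv_pos: "g \<in> L \<Longrightarrow> 0 < deriv g x"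
begin

text \<open>
  The first letter of a word acts last, so that the partial products of a word acting on a point are
  the words given by its suffixes, and all estimates go by recursion on lists.
\<close>

primrec word :: "bool list \<Rightarrow> real \<Rightarrow> real" where
  "word [] = (\<lambda>x. x)"
| "word (c # u) = (\<lambda>x. f c (word u x))"

lemma word_in: "word u \<in> L"
  by (induction u) (auto intro: id_in comp f_in)

lemma word_snoc: "word (u @ [c]) x = word u (f c x)"
  by (induction u) auto

lemma deriv_comp: "g \<in> L \<Longrightarrow> h \<in> L \<Longrightarrow> deriv (\<lambda>x. g (h x)) x = deriv g (h x) * deriv h x"
  by (intro DERIV_imp_deriv DERIV_chain2 has_deriv)

lemma word_near:
  assumes "u \<noteq> []" "\<not> near (B (last u)) \<eta> x"
  shows "near (A (hd u)) \<eta> (word u x)"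
  using assms
proof (induction u)
  case (Cons c u)
  show ?case
  proof (cases "u = []")
    case True
    then show ?thesis using Cons.prems contract by simp
  next
    case False
    then have "near (A (hd u)) \<eta> (word u x)" using Cons by simp
    then have "near (A (hd u)) (2 * \<eta>) (word u x)" by (rule near_mono) (use eta in simp)
    then have "\<not> near (B c) (2 * \<eta>) (word u x)" by (rule disj_AB)
    then have "\<not> near (B c) \<eta> (word u x)" using near_mono[of _ \<eta> _ "2 * \<eta>"] eta by auto
    then show ?thesis using contract by simp
  qed
qed simp

definition word_image :: "bool list \<Rightarrow> real set" where
  "word_image u = word u ` {x. \<not> near (B (last u)) \<eta> x}"

definition word_size :: "bool list \<Rightarrow> real" where
  "word_size u = measure lborel (word_image u \<inter> {0..<P})"

lemma word_size_nonneg: "0 \<le> word_size u"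
  by (simp add: word_size_def)

lemma word_image_periodic: "x + P \<in> word_image u \<longleftrightarrow> x \<in> word_image u"
proof -
  have "x + of_int m * P \<in> word_image u" if x: "x \<in> word_image u" for x and m :: int
  proof -
    obtain y where y: "x = word u y" "\<not> near (B (last u)) \<eta> y" using x by (auto simp: word_image_def)
    then have "x + of_int m * P = word u (y + of_int m * P)" using periodic_int[OF word_in] by simp
    moreover have "\<not> near (B (last u)) \<eta> (y + of_int m * P)" using y(2) near_periodic_int by simp
    ultimately show ?thesis unfolding word_image_def by blast
  qed
  from this[of x 1] this[of "x + P" "- 1"] show ?thesis by auto
qed

lemma word_image_borel: "word_image u \<in> sets borel"
proof -
  obtain g where g: "g \<in> L" "\<And>x. g (word u x) = x" "\<And>x. word u (g x) = x"
    using inverse[OF word_in] by blast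
  have eq: "word_image u = g -` {x. \<not> near (B (last u)) \<eta> x}"
  proof (intro equalityI subsetI)
    fix y assume "y \<in> word_image u"
    then show "y \<in> g -` {x. \<not> near (B (last u)) \<eta> x}" using g(2) by (auto simp: word_image_def)
  next
    fix y assume "y \<in> g -` {x. \<not> near (B (last u)) \<eta> x}"
    then have "word u (g y) \<in> word_image u" unfolding word_image_def by blast
    then show "y \<in> word_image u" using g(3) by simp
  qed
  have "closed {x. \<not> near (B (last u)) \<eta> x}"
    using open_near[of "B (last u)" \<eta>] by (simp add: closed_def Collect_neg_eq)
  then have "closed (word_image u)" unfolding eq using cont[OF g(1)] by (intro closed_vimage)
  then show ?thesis by simp
qed

text \<open>
  The image of a word lies near \<open>A\<close> of its first letter; for equal first letters that letter can be cancelled.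
\<close>

lemma word_image_disjoint:
  assumes "length u = length v" "u \<noteq> []" "u \<noteq> v"
  shows "word_image u \<inter> word_image v = {}"
  using assms
proof (induction u v rule: list_induct2)
  case (Cons c u d v)
  show ?case
  proof (cases "c = d")
    case False
    have "near (A c) \<eta> x \<and> near (A d) \<eta> x" if "x \<in> word_image (c # u)" "x \<in> word_image (d # v)" for x
      using that word_near[of "c # u"] word_near[of "d # v"] unfolding word_image_def by auto
    moreover have "\<eta> \<le> 2 * \<eta>" using eta by simp
    ultimately show ?thesis using False disj_A near_mono by blast
  next
    case True
    then have "u \<noteq> v" "u \<noteq> []" "v \<noteq> []" using Cons by auto
    then have "word_image u \<inter> word_image v = {}" using Cons by simp
    moreover have "word_image (c # u) = f c ` word_image u" "word_image (d # v) = f d ` word_image v"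
      using \<open>u \<noteq> []\<close> \<open>v \<noteq> []\<close> by (auto simp: word_image_def)
    moreover have "inj (f c)" using mono[OF f_in] by (rule strict_mono_imp_inj_on)
    ultimately show ?thesis using True by (simp add: image_Int[symmetric])
  qed
qed simp

lemma sum_size:
  assumes "n \<noteq> 0"
  shows "(\<Sum>u | length u = n. word_size u) \<le> P"
proof -
  have fin: "finite {u :: bool list. length u = n}" using finite_lists_length_eq[of "UNIV :: bool set" n] by simp
  have "(\<Sum>u | length u = n. word_size u) = measure lborel (\<Union>u\<in>{u. length u = n}. word_image u \<inter> {0..<P})"
    unfolding word_size_def
  proof (rule measure_finite_Union[symmetric, OF fin])
    show "disjoint_family_on (\<lambda>u. word_image u \<inter> {0..<P}) {u. length u = n}"
      unfolding disjoint_family_on_def using word_image_disjoint assms by fastforce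
    show "emeasure lborel (word_image u \<inter> {0..<P}) \<noteq> \<infinity>" for u
      using emeasure_mono[of "word_image u \<inter> {0..<P}" "{0..<P}" lborel] by (auto simp: top_unique emeasure_lborel_Ico[OF less_imp_le[OF P_pos]])
  qed (use word_image_borel in auto)
  also have "\<dots> \<le> measure lborel {0..<P}"
    using word_image_borel P_pos by (intro measure_mono_fmeasurable fmeasurableI) (auto intro!: sets.finite_UN fin)
  finally show ?thesis using P_pos by simp
qed

lemma interval_size:
  assumes "\<And>y. y \<in> {x..x + \<eta>} \<Longrightarrow> \<not> near (B (last u)) \<eta> y"
  shows "word u (x + \<eta>) - word u x \<le> word_size u"
proof -
  define a b where "a = word u x" and "b = word u (x + \<eta>)"
  have ab: "a \<le> b" using le_iff[OF word_in] eta by (simp add: a_def b_def)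
  have "b \<le> word u (x + P)" using le_iff[OF word_in] eta by (simp add: b_def)
  then have bP: "b \<le> a + P" using periodic[OF word_in] by (simp add: a_def)
  have "{a..<b} \<subseteq> word_image u \<inter> {a..<a + P}"
  proof
    fix y assume y: "y \<in> {a..<b}"
    obtain g where g: "g \<in> L" "\<And>x. g (word u x) = x" "\<And>x. word u (g x) = x"
      using inverse[OF word_in] by blast
    have "x \<le> g y" "g y \<le> x + \<eta>" using y g le_iff[OF g(1)] unfolding a_def b_def
      by (metis atLeastLessThan_iff less_imp_le)+
    then have "y \<in> word_image u" unfolding word_image_def using assms[of "g y"] g(3)[of y] by force
    then show "y \<in> word_image u \<inter> {a..<a + P}" using y bP by auto
  qed
  then have "emeasure lborel {a..<b} \<le> emeasure lborel (word_image u \<inter> {a..<a + P})"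
    using word_image_borel by (intro emeasure_mono) auto
  also have "\<dots> = emeasure lborel (word_image u \<inter> {0..<P})"
    by (rule emeasure_periodic_window[OF word_image_borel word_image_periodic P_pos])
  also have "\<dots> = ennreal (word_size u)" unfolding word_size_def
    using emeasure_mono[of "word_image u \<inter> {0..<P}" "{0..<P}" lborel]
    by (intro emeasure_eq_ennreal_measure) (auto simp: top_unique emeasure_lborel_Ico[OF less_imp_le[OF P_pos]])
  finally show ?thesis using ab word_size_nonneg by (simp add: a_def b_def)
qed

text \<open>
  The weight is large as soon as one suffix of the word has a large image. As the \<open>2\<^sup>n\<close> images of words of length
  \<open>n\<close> are disjoint, their average size is at most \<open>P / 2\<^sup>n\<close>; the factor \<open>(4/3)\<^sup>n\<close> is beaten by \<open>2\<^sup>n\<close>, so weights are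
  bounded on average, while a bounded weight forces the sizes of the suffixes to decay like \<open>(3/4)\<^sup>n\<close>.
\<close>

primrec weight :: "bool list \<Rightarrow> real" where
  "weight [] = 0"
| "weight (c # u) = weight u + (4/3) ^ length (c # u) * word_size (c # u)"

lemma weight_nonneg: "0 \<le> weight u"
  by (induction u) (simp_all add: word_size_nonneg)

lemma weight_tail_le: "weight u \<le> weight (c # u)"
  by (simp add: word_size_nonneg)

lemma word_size_le:
  assumes "u \<noteq> []" "weight u \<le> C"
  shows "word_size u \<le> C * (3/4) ^ length u"
proof -
  obtain c v where u: "u = c # v" using assms(1) by (cases u) auto
  have "(4/3) ^ length u * word_size u \<le> C" using assms(2) weight_nonneg[of v] unfolding u weight.simps by linarith
  then show ?thesis by (simp add: field_simps power_divide)
qed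

lemma sum_words_Suc:
  "(\<Sum>u | length u = Suc n. F u) = (\<Sum>u | length u = n. \<Sum>c\<in>UNIV. F (c # u :: bool list))"
  for F :: "bool list \<Rightarrow> real"
proof -
  have "(\<Sum>u | length u = Suc n. F u) = (\<Sum>(u, c)\<in>{u. length u = n} \<times> UNIV. F (c # u))"
    by (intro sum.reindex_bij_witness[of _ "\<lambda>(u, c). c # u" "\<lambda>u. (tl u, hd u)"])
       (auto simp: length_Suc_conv)
  then show ?thesis by (simp add: sum.cartesian_product)
qed

lemma sum_weight: "(\<Sum>u | length u = n. weight u) \<le> 2 * P * (2 ^ n - (4/3) ^ n)"
proof (induction n)
  case (Suc n)
  have "(\<Sum>u | length u = Suc n. weight u)
      = (\<Sum>u | length u = n. \<Sum>c\<in>UNIV. weight u + (4/3) ^ Suc n * word_size (c # u))"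
    unfolding sum_words_Suc by (intro sum.cong) auto
  also have "\<dots> = 2 * (\<Sum>u | length u = n. weight u) + (4/3) ^ Suc n * (\<Sum>u | length u = Suc n. word_size u)"
    unfolding sum_words_Suc
    by (simp only: UNIV_bool sum.distrib sum_distrib_left distrib_left mult_2)
       (simp add: sum.distrib sum_distrib_left)
  also have "\<dots> \<le> 2 * (2 * P * (2 ^ n - (4/3) ^ n)) + (4/3) ^ Suc n * P"
    using Suc sum_size[of "Suc n"] by (intro add_mono mult_left_mono) auto
  also have "\<dots> = 2 * P * (2 ^ Suc n - (4/3) ^ Suc n)" by (simp add: field_simps)
  finally show ?case .
qed simp

lemma deriv_periodic: "g \<in> L \<Longrightarrow> deriv g (x + of_int n * P) = deriv g x"
proof -
  assume g: "g \<in> L"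
  have "((\<lambda>y. g (y + of_int n * P)) has_real_derivative deriv g (x + of_int n * P) * 1) (at x)"
    by (rule DERIV_chain2[OF has_deriv[OF g]]) (auto intro!: derivative_eq_intros)
  moreover have "(\<lambda>y. g (y + of_int n * P)) = (\<lambda>y. g y + of_int n * P)" using periodic_int[OF g] by auto
  moreover have "((\<lambda>y. g y + of_int n * P) has_real_derivative deriv g x) (at x)"
    using DERIV_add[OF has_deriv[OF g] DERIV_const] by fastforce
  ultimately show ?thesis by (metis DERIV_unique mult_1_right)
qed

text \<open>
  The derivative is periodic, so it is uniformly continuous and bounded away from 0 and from above.
\<close>

lemma deriv_distortion:
  assumes g: "g \<in> L" and \<rho>: "1 < \<rho>"
  obtains K \<delta> where "1 \<le> K" "0 < \<delta>" "\<And>s t. deriv g s \<le> K * deriv g t"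
    "\<And>s t. \<bar>s - t\<bar> < \<delta> \<Longrightarrow> deriv g s \<le> \<rho> * deriv g t"
proof -
  let ?d = "deriv g"
  have cont: "continuous_on S ?d" for S using cont_deriv[OF g] continuous_on_subset by blast
  obtain m where m: "m \<in> {0..P}" "\<And>y. y \<in> {0..P} \<Longrightarrow> ?d m \<le> ?d y"
    using continuous_attains_inf[of "{0..P}" ?d] cont P_pos by auto
  obtain M where M: "M \<in> {0..P}" "\<And>y. y \<in> {0..P} \<Longrightarrow> ?d y \<le> ?d M"
    using continuous_attains_sup[of "{0..P}" ?d] cont P_pos by auto
  have bounds: "?d m \<le> ?d y" "?d y \<le> ?d M" for y
  proof -
    obtain n :: int where "0 \<le> y + of_int n * P" "y + of_int n * P < 0 + P" using reduce by blast
    then show "?d m \<le> ?d y" "?d y \<le> ?d M"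
      using m(2)[of "y + of_int n * P"] M(2)[of "y + of_int n * P"] deriv_periodic[OF g] by simp_all
  qed
  have "uniformly_continuous_on {0..2 * P} ?d" by (intro compact_uniformly_continuous cont) simp
  moreover have "0 < (\<rho> - 1) * ?d m" using \<rho> deriv_pos[OF g] by simp
  ultimately obtain d where d: "d > 0"
    "\<And>s t. s \<in> {0..2 * P} \<Longrightarrow> t \<in> {0..2 * P} \<Longrightarrow> dist t s < d \<Longrightarrow> dist (?d t) (?d s) < (\<rho> - 1) * ?d m"
    unfolding uniformly_continuous_on_def by blast
  show ?thesis
  proof (rule that)
    show "1 \<le> ?d M / ?d m" using bounds deriv_pos[OF g] by simp
    show "0 < min d (P / 2)" using d P_pos by simp
    show "?d s \<le> ?d M / ?d m * ?d t" for s t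
    proof -
      have "?d s * ?d m \<le> ?d M * ?d t"
        using bounds[of s] bounds[of t] deriv_pos[OF g] by (intro mult_mono) (auto intro: less_imp_le)
      then show ?thesis using deriv_pos[OF g, of m] by (simp add: field_simps)
    qed
    show "?d s \<le> \<rho> * ?d t" if st: "\<bar>s - t\<bar> < min d (P / 2)" for s t
    proof -
      obtain n :: int where n: "P / 2 \<le> t + of_int n * P" "t + of_int n * P < P / 2 + P" using reduce by blast
      have "\<bar>s - t\<bar> < P / 2" "\<bar>s - t\<bar> < d" using st by auto
      then have "s + of_int n * P \<in> {0..2 * P}" "t + of_int n * P \<in> {0..2 * P}"
        using n P_pos unfolding atLeastAtMost_iff by linarith+
      then have "dist (?d (s + of_int n * P)) (?d (t + of_int n * P)) < (\<rho> - 1) * ?d m"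
        using \<open>\<bar>s - t\<bar> < d\<close> by (intro d(2)) (auto simp: dist_real_def)
      then have "?d s < ?d t + (\<rho> - 1) * ?d m" using deriv_periodic[OF g] by (simp add: dist_real_def)
      also have "\<dots> \<le> ?d t + (\<rho> - 1) * ?d t" using bounds \<rho> by (intro add_left_mono mult_left_mono) auto
      finally show ?thesis by (simp add: algebra_simps)
    qed
  qed
qed

text \<open>
  Distortion control for maps that are only continuously differentiable. Along a word of bounded weight the
  intermediate images of an interval of length \<open>\<eta>\<close> shrink like \<open>(3/4)\<^sup>n\<close>; hence all but a bounded number of factors
  of the derivative vary by a ratio of at most \<open>7/6\<close> on it, and the derivatives of the word at two points of the interval
  differ by a factor of at most a constant times \<open>(7/6)\<^sup>n\<close>. At some point the derivative equals the quotient of the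
  lengths, of order \<open>(3/4)\<^sup>n\<close>, so everywhere it is at most a constant times \<open>(7/8)\<^sup>n\<close>.
\<close>

lemma long_words_contract:
  assumes C: "P \<le> C"
  shows "\<exists>N. \<forall>u x. N \<le> length u \<longrightarrow> weight u \<le> C \<longrightarrow> \<not> near (B (last u)) (2 * \<eta>) x
     \<longrightarrow> deriv (word u) x \<le> 1 / 2"
proof -
  have "\<exists>K \<delta>. 1 \<le> K \<and> 0 < \<delta> \<and> (\<forall>s t. deriv (f c) s \<le> K * deriv (f c) t)
      \<and> (\<forall>s t. \<bar>s - t\<bar> < \<delta> \<longrightarrow> deriv (f c) s \<le> 7 / 6 * deriv (f c) t)" for c
    by (rule deriv_distortion[OF f_in[of c], of "7/6"]) (simp, blast)
  then obtain K0 \<delta>0 where K0: "\<And>c. 1 \<le> K0 c" "\<And>c. 0 < \<delta>0 c"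
    "\<And>c s t. deriv (f c) s \<le> K0 c * deriv (f c) t"
    "\<And>c s t. \<bar>s - t\<bar> < \<delta>0 c \<Longrightarrow> deriv (f c) s \<le> 7 / 6 * deriv (f c) t" by metis
  define K where "K = 7 / 6 * max (K0 True) (K0 False)"
  define \<delta> where "\<delta> = min (\<delta>0 True) (\<delta>0 False)"
  have K: "K0 c \<le> K" "7 / 6 \<le> K" for c using K0(1)[of True] K0(1)[of False] by (cases c; simp add: K_def max_def)+
  have "\<delta> > 0" "\<delta> \<le> \<delta>0 c" for c using K0(2) by (cases c; simp add: \<delta>_def)+
  have "(\<lambda>n. C * (3/4) ^ n) \<longlonglongrightarrow> C * 0" by (intro tendsto_intros LIMSEQ_realpow_zero) auto
  then have "eventually (\<lambda>n. C * (3/4) ^ n < \<delta>) sequentially" using \<open>\<delta> > 0\<close> by (intro order_tendstoD(2)) auto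
  then obtain m where m: "\<And>n. n \<ge> m \<Longrightarrow> C * (3/4) ^ n < \<delta>" by (auto simp: eventually_sequentially)
  define \<rho> where "\<rho> n = (if n < m then K else 7 / 6)" for n
  have \<rho>: "deriv (f c) s \<le> \<rho> n * deriv (f c) t" if st: "\<bar>s - t\<bar> \<le> C * (3/4) ^ n" for n c s t
  proof (cases "n < m")
    case True
    have "deriv (f c) s \<le> K0 c * deriv (f c) t" by (rule K0(3))
    also have "\<dots> \<le> K * deriv (f c) t" using K deriv_pos[OF f_in] by (intro mult_right_mono) (auto intro: less_imp_le)
    finally show ?thesis using True by (simp add: \<rho>_def)
  next
    case False
    then have "\<bar>s - t\<bar> < \<delta>0 c" using st m[of n] \<open>\<delta> \<le> \<delta>0 c\<close> by linarith
    then show ?thesis using K0(4) False by (simp add: \<rho>_def)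
  qed
  have \<rho>_pos: "0 < \<rho> n" for n using K(2) by (simp add: \<rho>_def)
  have prod: "(\<Prod>n<k. \<rho> n) \<le> K ^ m * (7/6) ^ k" for k
  proof -
    have "K ^ m * (7/6) ^ k \<ge> (if k \<le> m then K ^ k else K ^ m * (7/6) ^ (k - m))"
    proof (cases "k \<le> m")
      case True
      have "K ^ k * 1 \<le> K ^ m * (7/6) ^ k" using K(2) True by (intro mult_mono power_increasing) auto
      then show ?thesis using True by simp
    next
      case False
      have "(7/6::real) ^ (k - m) \<le> (7/6) ^ k" by (intro power_increasing) auto
      then show ?thesis using False K(2) by (simp add: mult_left_mono)
    qed
    moreover have "(\<Prod>n<k. \<rho> n) = (if k \<le> m then K ^ k else K ^ m * (7/6) ^ (k - m))"
    proof (induction k)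
      case (Suc k)
      consider "k < m" | "k = m" | "k > m" by linarith
      then show ?case using Suc by cases (auto simp: \<rho>_def Suc_diff_le)
    qed simp
    ultimately show ?thesis by simp
  qed
  have distortion: "deriv (word u) s \<le> (\<Prod>n<length u. \<rho> n) * deriv (word u) t"
    if "u \<noteq> []" "weight u \<le> C" "\<And>y. y \<in> {x..x + \<eta>} \<Longrightarrow> \<not> near (B (last u)) \<eta> y"
      "s \<in> {x..x + \<eta>}" "t \<in> {x..x + \<eta>}" for u x s t
    using that
  proof (induction u)
    case (Cons c u)
    have close: "\<bar>word u s - word u t\<bar> \<le> C * (3/4) ^ length u"
    proof (cases "u = []")
      case True
      then show ?thesis using Cons.prems eta C by auto
    next
      case False
      then have "word_size u \<le> C * (3/4) ^ length u"
        using word_size_le weight_tail_le Cons.prems(2) order_trans by blast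
      moreover have "word u (x + \<eta>) - word u x \<le> word_size u"
        using Cons.prems(3) False by (intro interval_size) auto
      moreover have "word u s \<in> {word u x..word u (x + \<eta>)}" "word u t \<in> {word u x..word u (x + \<eta>)}"
        using Cons.prems(4,5) le_iff[OF word_in] by auto
      ultimately show ?thesis by auto
    qed
    have IH: "deriv (word u) s \<le> (\<Prod>n<length u. \<rho> n) * deriv (word u) t"
    proof (cases "u = []")
      case False
      have "weight u \<le> C" using weight_tail_le Cons.prems(2) order_trans by blast
      then show ?thesis using False Cons by (intro Cons.IH) auto
    qed simp
    have "deriv (word (c # u)) s = deriv (f c) (word u s) * deriv (word u) s"
      using deriv_comp[OF f_in word_in] by simp
    also have "\<dots> \<le> (\<rho> (length u) * deriv (f c) (word u t)) * ((\<Prod>n<length u. \<rho> n) * deriv (word u) t)"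
      using deriv_pos[OF f_in] deriv_pos[OF word_in] \<rho>_pos
      by (intro mult_mono \<rho> close IH) (auto intro: less_imp_le)
    also have "\<dots> = (\<Prod>n<length (c # u). \<rho> n) * deriv (word (c # u)) t"
      using deriv_comp[OF f_in word_in] by simp
    finally show ?case .
  qed simp
  have "(\<lambda>n. K ^ m * C / \<eta> * (7/8) ^ n) \<longlonglongrightarrow> K ^ m * C / \<eta> * 0" by (intro tendsto_intros LIMSEQ_realpow_zero) auto
  then have "eventually (\<lambda>n. K ^ m * C / \<eta> * (7/8) ^ n < 1 / 2) sequentially" by (intro order_tendstoD(2)) auto
  then obtain N where N: "\<And>n. n \<ge> N \<Longrightarrow> K ^ m * C / \<eta> * (7/8) ^ n < 1 / 2" by (auto simp: eventually_sequentially)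
  have "deriv (word u) x \<le> 1 / 2"
    if u: "Suc N \<le> length u" "weight u \<le> C" "\<not> near (B (last u)) (2 * \<eta>) x" for u x
  proof -
    have far: "\<not> near (B (last u)) \<eta> y" if "y \<in> {x..x + \<eta>}" for y
      using near_move[of _ \<eta> y x \<eta>] u(3) that by auto
    have ne: "u \<noteq> []" using u(1) by auto
    have size: "word_size u \<le> C * (3/4) ^ length u" by (rule word_size_le[OF ne u(2)])
    obtain t where t: "x < t" "t < x + \<eta>" "word u (x + \<eta>) - word u x = (x + \<eta> - x) * deriv (word u) t"
      using MVT2[of x "x + \<eta>" "word u" "deriv (word u)"] has_deriv[OF word_in] eta by auto
    have "\<eta> * deriv (word u) t \<le> C * (3/4) ^ length u" using t(3) interval_size[of x u, OF far] size by simp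
    then have dt: "deriv (word u) t \<le> C * (3/4) ^ length u / \<eta>" using eta by (simp add: field_simps)
    have "deriv (word u) x \<le> (\<Prod>n<length u. \<rho> n) * deriv (word u) t"
      using ne u(2) t(1,2) far eta by (intro distortion[where x = x]) auto
    also have "\<dots> \<le> (K ^ m * (7/6) ^ length u) * (C * (3/4) ^ length u / \<eta>)"
      using prod dt deriv_pos[OF word_in] K(2) by (intro mult_mono) (auto intro: less_imp_le)
    also have "\<dots> = K ^ m * C / \<eta> * ((7/6) * (3/4)) ^ length u" by (simp only: power_mult_distrib) simp
    also have "\<dots> \<le> 1 / 2" using N[of "length u"] u(1) by simp
    finally show ?thesis .
  qed
  then show ?thesis by blast
qed

end

section \<open>An element with hyperbolic fixed points\<close>

context C1_ping_pong begin

lemma inverse_system: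
  obtains f' where "C1_ping_pong L P f' B A \<eta>" "\<And>c x. f' c (f c x) = x" "\<And>c x. f c (f' c x) = x"
proof -
  have "\<exists>g. g \<in> L \<and> (\<forall>x. g (f c x) = x \<and> f c (g x) = x)" for c using inverse[OF f_in] by blast
  then obtain f' where f': "\<And>c. f' c \<in> L" "\<And>c x. f' c (f c x) = x" "\<And>c x. f c (f' c x) = x" by metis
  have "C1_ping_pong L P f' B A \<eta>"
  proof
    show "near (B c) \<eta> (f' c x)" if far: "\<not> near (A c) \<eta> x" for c x
    proof (rule ccontr)
      assume "\<not> near (B c) \<eta> (f' c x)"
      from contract[OF this] show False using far f'(3) by simp
    qed
    show "\<not> near (A d) (2 * \<eta>) x" if "near (B c) (2 * \<eta>) x" for c d x using disj_AB that by blast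
  qed (use f' eta disj_A disj_B has_deriv cont_deriv deriv_pos in auto)
  then show ?thesis using that f' by blast
qed

text \<open>
  The inverse of a word is the reversed word in the inverse system. Averaging over all words of a given
  length the sum of the weight of the word and the weight of its inverse shows that some word has both
  weights bounded, and then the word and its inverse both contract.
\<close>

lemma contracting_word:
  obtains F F' c d where "F \<in> L" "F' \<in> L" "\<And>x. F' (F x) = x" "\<And>x. F (F' x) = x"
    "\<And>x. \<not> near (B d) \<eta> x \<Longrightarrow> near (A c) \<eta> (F x)"
    "\<And>x. \<not> near (B d) (2 * \<eta>) x \<Longrightarrow> deriv F x \<le> 1 / 2"
    "\<And>x. \<not> near (A c) \<eta> x \<Longrightarrow> near (B d) \<eta> (F' x)"
    "\<And>x. \<not> near (A c) (2 * \<eta>) x \<Longrightarrow> deriv F' x \<le> 1 / 2"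
proof -
  obtain f' where f': "C1_ping_pong L P f' B A \<eta>" "\<And>c x. f' c (f c x) = x" "\<And>c x. f c (f' c x) = x"
    using inverse_system by blast
  interpret inv: C1_ping_pong L P f' B A \<eta> by (rule f'(1))
  have C: "P \<le> 4 * P" using P_pos by simp
  obtain N where N: "\<And>u x. N \<le> length u \<Longrightarrow> weight u \<le> 4 * P \<Longrightarrow>
      \<not> near (B (last u)) (2 * \<eta>) x \<Longrightarrow> deriv (word u) x \<le> 1 / 2"
    using long_words_contract[OF C] by blast
  obtain N' where N': "\<And>u x. N' \<le> length u \<Longrightarrow> inv.weight u \<le> 4 * P \<Longrightarrow>
      \<not> near (A (last u)) (2 * \<eta>) x \<Longrightarrow> deriv (inv.word u) x \<le> 1 / 2"
    using inv.long_words_contract[OF C] by blast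
  define n where "n = Suc (max N N')"
  have fin: "finite {u :: bool list. length u = n}" and card: "card {u :: bool list. length u = n} = 2 ^ n"
    using finite_lists_length_eq[of "UNIV :: bool set" n] card_lists_length_eq[of "UNIV :: bool set" n] by simp_all
  have "\<exists>u. length u = n \<and> weight u + inv.weight (rev u) \<le> 4 * P"
  proof (rule ccontr)
    assume "\<not> ?thesis"
    then have big: "\<And>u. length u = n \<Longrightarrow> 4 * P \<le> weight u + inv.weight (rev u)" by force
    have "2 ^ n * (4 * P) = (\<Sum>u::bool list | length u = n. 4 * P)" using card by simp
    also have "\<dots> \<le> (\<Sum>u | length u = n. weight u + inv.weight (rev u))"
      using big by (intro sum_mono) auto
    also have "\<dots> = (\<Sum>u | length u = n. weight u) + (\<Sum>u | length u = n. inv.weight (rev u))"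
      by (rule sum.distrib)
    also have "(\<Sum>u | length u = n. inv.weight (rev u)) = (\<Sum>u | length u = n. inv.weight u)"
      by (rule sum.reindex_bij_witness[of _ rev rev]) auto
    also have "(\<Sum>u | length u = n. weight u) + \<dots> \<le> 2 * P * (2 ^ n - (4/3) ^ n) + 2 * P * (2 ^ n - (4/3) ^ n)"
      by (intro add_mono sum_weight inv.sum_weight)
    also have "\<dots> = 2 ^ n * (4 * P) - 4 * P * (4/3) ^ n" by (simp add: algebra_simps)
    finally have "4 * P * (4/3) ^ n \<le> 0" by simp
    moreover have "0 < 4 * P * (4/3) ^ n" using P_pos by simp
    ultimately show False by linarith
  qed
  then obtain u where u: "length u = n" "weight u + inv.weight (rev u) \<le> 4 * P" by blast
  have ne: "u \<noteq> []" using u(1) by (auto simp: n_def)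
  have w: "weight u \<le> 4 * P" "inv.weight (rev u) \<le> 4 * P"
    using u(2) weight_nonneg[of u] inv.weight_nonneg[of "rev u"] by linarith+
  have cancel: "inv.word (rev v) (word v x) = x" "word v (inv.word (rev v) x) = x" for v x
    by (induction v arbitrary: x) (simp_all add: inv.word_snoc f'(2,3))
  show ?thesis
  proof (rule that[of "word u" "inv.word (rev u)" "last u" "hd u"])
    show "near (A (hd u)) \<eta> (word u x)" if "\<not> near (B (last u)) \<eta> x" for x
      by (rule word_near[OF ne that])
    show "near (B (last u)) \<eta> (inv.word (rev u) x)" if "\<not> near (A (hd u)) \<eta> x" for x
      using inv.word_near[of "rev u" x] ne that by (simp add: last_rev hd_rev)
    show "deriv (word u) x \<le> 1 / 2" if "\<not> near (B (last u)) (2 * \<eta>) x" for x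
      using N[OF _ w(1) that] u(1) by (simp add: n_def)
    show "deriv (inv.word (rev u)) x \<le> 1 / 2" if "\<not> near (A (hd u)) (2 * \<eta>) x" for x
      using N'[OF _ w(2), of x] u(1) that by (simp add: n_def last_rev)
  qed (simp_all add: word_in inv.word_in cancel)
qed

lemma funpow_in: "g \<in> L \<Longrightarrow> g ^^ n \<in> L"
  using comp id_in by (induction n) (auto simp: id_def o_def)

lemma deriv_funpow_le:
  assumes g: "g \<in> L" and U: "\<And>x. U x \<Longrightarrow> U (g x)" "\<And>x. U x \<Longrightarrow> deriv g x \<le> 1 / 2" and x: "U x"
  shows "deriv (g ^^ n) x \<le> (1 / 2) ^ n"
proof (induction n)
  case (Suc n)
  have "U ((g ^^ n) x)" by (induction n) (auto simp: x U(1))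
  then have "deriv g ((g ^^ n) x) \<le> 1 / 2" by (rule U(2))
  then have "deriv g ((g ^^ n) x) * deriv (g ^^ n) x \<le> 1 / 2 * (1 / 2) ^ n"
    using Suc deriv_pos[OF funpow_in[OF g]] by (intro mult_mono) (auto intro: less_imp_le)
  then show ?case using deriv_comp[OF g funpow_in[OF g]] by (simp add: o_def)
qed (simp add: id_def)

lemma recurrence:
  fixes y :: "nat \<Rightarrow> real"
  assumes "0 < e"
  obtains i j :: nat and m :: int where "i < j" "\<bar>y j - (y i + of_int m * P)\<bar> < e"
proof -
  have "\<exists>m::int. 0 \<le> y i + of_int m * P \<and> y i + of_int m * P < 0 + P" for i by (rule reduce)
  then obtain m :: "nat \<Rightarrow> int" where m: "\<And>i. 0 \<le> y i + of_int (m i) * P" "\<And>i. y i + of_int (m i) * P < P"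
    by (metis add_0)
  define k where "k i = \<lfloor>(y i + of_int (m i) * P) / e\<rfloor>" for i
  have "k i \<in> {0..\<lfloor>P / e\<rfloor>}" for i
  proof -
    have "0 \<le> (y i + of_int (m i) * P) / e" "(y i + of_int (m i) * P) / e \<le> P / e"
      using m[of i] assms by (simp_all add: divide_right_mono)
    then show ?thesis unfolding k_def by (simp add: floor_mono)
  qed
  then have "range k \<subseteq> {0..\<lfloor>P / e\<rfloor>}" by blast
  then have "finite (range k)" using finite_subset finite_atLeastAtMost_int by blast
  then have "\<not> inj k" using finite_imageD infinite_UNIV_nat by blast
  then obtain p q where pq: "k p = k q" "p \<noteq> q" unfolding inj_on_def by blast
  define i j where "i = min p q" and "j = max p q"
  have ij: "k i = k j" "i < j" using pq by (auto simp: i_def j_def min_def max_def)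
  let ?a = "y i + of_int (m i) * P" and ?b = "y j + of_int (m j) * P"
  have "\<bar>?a / e - ?b / e\<bar> < 1" using ij(1) unfolding k_def by linarith
  then have "\<bar>?a - ?b\<bar> < e" using assms by (simp add: diff_divide_distrib[symmetric] abs_divide divide_less_eq)
  moreover have "?b - ?a = y j - (y i + of_int (m i - m j) * P)" by (simp add: algebra_simps)
  ultimately have "\<bar>y j - (y i + of_int (m i - m j) * P)\<bar> < e" by linarith
  then show ?thesis using that ij(2) by blast
qed

text \<open>
  Every point is away from \<open>B d\<close>, where all iterates of \<open>F\<close> contract, or away from \<open>A c\<close>, where all iterates
  of \<open>F'\<close> do; so no fixed point of an iterate has derivative 1. For the existence of a fixed point, an
  orbit near \<open>A c\<close> returns close to one of its points \<open>y\<close> modulo \<open>P\<close>, and the corresponding iterate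
  maps the interval of radius \<open>\<eta>\<close> around \<open>y\<close> into a translate of itself.
\<close>

lemma hyperbolic_element:
  assumes ne: "\<And>c. A c \<noteq> {}"
  obtains g where "g \<in> L" "\<exists>x. \<exists>n::int. g x = x + of_int n * P"
    "\<And>x n. g x = x + of_int n * P \<Longrightarrow> deriv g x \<noteq> 1"
proof -
  obtain F F' c d where F: "F \<in> L" "F' \<in> L" "\<And>x. F' (F x) = x" "\<And>x. F (F' x) = x"
    "\<And>x. \<not> near (B d) \<eta> x \<Longrightarrow> near (A c) \<eta> (F x)"
    "\<And>x. \<not> near (B d) (2 * \<eta>) x \<Longrightarrow> deriv F x \<le> 1 / 2"
    "\<And>x. \<not> near (A c) \<eta> x \<Longrightarrow> near (B d) \<eta> (F' x)"
    "\<And>x. \<not> near (A c) (2 * \<eta>) x \<Longrightarrow> deriv F' x \<le> 1 / 2"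
    using contracting_word by metis
  have wide: "near X (2 * \<eta>) x" if "near X \<eta> x" for X x using near_mono[OF that] eta by simp
  have invB: "\<not> near (B d) (2 * \<eta>) (F x)" if "\<not> near (B d) (2 * \<eta>) x" for x
    using F(5) wide disj_AB that by blast
  have invA: "\<not> near (A c) (2 * \<eta>) (F' x)" if "\<not> near (A c) (2 * \<eta>) x" for x
    using F(7) wide disj_AB that by blast
  have contr: "deriv (F ^^ n) x \<le> (1 / 2) ^ n" if "\<not> near (B d) (2 * \<eta>) x" for n x
    using deriv_funpow_le[OF F(1), of "\<lambda>x. \<not> near (B d) (2 * \<eta>) x"] invB F(6) that by blast
  have contr': "deriv (F' ^^ n) x \<le> (1 / 2) ^ n" if "\<not> near (A c) (2 * \<eta>) x" for n x
    using deriv_funpow_le[OF F(2), of "\<lambda>x. \<not> near (A c) (2 * \<eta>) x"] invA F(8) that by blast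
  obtain a where "a \<in> A c" using ne by blast
  then have "near (A c) (2 * \<eta>) a" using eta unfolding near_def by (intro bexI[of _ a] exI[of _ 0]) auto
  then have a: "\<not> near (B d) (2 * \<eta>) a" by (rule disj_AB)
  have far: "\<not> near (B d) (2 * \<eta>) ((F ^^ i) a)" for i by (induction i) (auto simp: a invB)
  have orbit: "near (A c) \<eta> ((F ^^ Suc i) a)" for i using F(5) far wide by auto
  obtain i j :: nat and m :: int where ij: "i < j"
    "\<bar>(F ^^ Suc j) a - ((F ^^ Suc i) a + of_int m * P)\<bar> < \<eta> / 2"
    using recurrence[of "\<eta> / 2" "\<lambda>i. (F ^^ Suc i) a"] eta by auto
  define l where "l = j - i"
  define y where "y = (F ^^ Suc i) a"
  define G where "G = F ^^ l"
  have l: "l \<noteq> 0" using ij by (simp add: l_def)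
  have "(F ^^ Suc j) a = (F ^^ (l + Suc i)) a" using ij(1) by (simp add: l_def)
  then have "(F ^^ Suc j) a = G y" unfolding G_def y_def funpow_add by simp
  then have Gy: "\<bar>G y - (y + of_int m * P)\<bar> < \<eta> / 2" using ij(2) by (simp add: y_def)
  have G: "G \<in> L" unfolding G_def by (rule funpow_in[OF F(1)])
  have half: "(1 / 2 :: real) ^ l \<le> 1 / 2" using l power_decreasing[of 1 l "1/2 :: real"] by simp
  have dG: "deriv G t \<le> 1 / 2" if "\<bar>t - y\<bar> \<le> \<eta>" for t
  proof -
    have "near (A c) (\<eta> + \<eta>) t" unfolding y_def by (rule near_move[OF orbit[of i]]) (use that y_def in simp)
    then have "\<not> near (B d) (2 * \<eta>) t" using disj_AB by simp
    then show ?thesis using contr[of t l] half unfolding G_def by linarith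
  qed
  have "G (y + \<eta>) - G y \<le> \<eta> / 2"
  proof -
    obtain t where "y < t" "t < y + \<eta>" "G (y + \<eta>) - G y = (y + \<eta> - y) * deriv G t"
      using MVT2[of y "y + \<eta>" G "deriv G"] has_deriv[OF G] eta by auto
    then show ?thesis using dG[of t] mult_left_mono[of "deriv G t" "1/2" \<eta>] eta by simp
  qed
  moreover have "G y - G (y - \<eta>) \<le> \<eta> / 2"
  proof -
    obtain t where "y - \<eta> < t" "t < y" "G y - G (y - \<eta>) = (y - (y - \<eta>)) * deriv G t"
      using MVT2[of "y - \<eta>" y G "deriv G"] has_deriv[OF G] eta by auto
    then show ?thesis using dG[of t] mult_left_mono[of "deriv G t" "1/2" \<eta>] eta by simp
  qed
  ultimately have ends: "G (y + \<eta>) - (y + \<eta>) \<le> of_int m * P" "of_int m * P \<le> G (y - \<eta>) - (y - \<eta>)"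
    using Gy by linarith+
  have "continuous_on {y - \<eta>..y + \<eta>} (\<lambda>x. G x - x)"
    using cont[OF G] continuous_on_subset by (intro continuous_intros) blast
  then obtain x where "G x - x = of_int m * P"
    using IVT2'[of "\<lambda>x. G x - x" "y + \<eta>" "of_int m * P" "y - \<eta>"] ends eta by auto
  then have fixed: "G x = x + of_int m * P" by simp
  have "deriv G x \<noteq> 1" if x: "G x = x + of_int n * P" for x n
  proof (cases "near (B d) (2 * \<eta>) x")
    case False
    then show ?thesis using contr[of x l] half unfolding G_def by linarith
  next
    case True
    then have "\<not> near (A c) (2 * \<eta>) (G x)" unfolding x near_periodic_int using disj_AB by blast
    then have "deriv (F' ^^ l) (G x) \<le> 1 / 2" using contr'[of "G x" l] half by linarith
    moreover have "(F' ^^ n) ((F ^^ n) x) = x" for n x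
      by (induction n arbitrary: x) (simp_all add: F(3) funpow_swap1)
    then have "(\<lambda>x. (F' ^^ l) (G x)) = (\<lambda>x. x)" unfolding G_def by auto
    then have "deriv (F' ^^ l) (G x) * deriv G x = 1"
      using deriv_comp[OF funpow_in[OF F(2)] G, of l x] by simp
    ultimately show ?thesis by auto
  qed
  then show ?thesis using that[OF G] fixed by blast
qed

end

section \<open>Lifts of circle diffeomorphisms\<close>

lemma cis_eq_imp: "cis a = cis b \<Longrightarrow> \<exists>n::int. a = b + of_int n * (2 * pi)"
proof -
  assume "cis a = cis b"
  then have "cis (a - b) = 1" by (simp add: cis_divide[symmetric])
  then have "cos (a - b) = 1" by (metis cis.simps(1) one_complex.simps(1))
  then obtain n :: int where "a - b = of_int n * 2 * pi" unfolding cos_one_2pi_int by blast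
  then show ?thesis by (intro exI[of _ n]) simp
qed

lemma cis_add_int: "cis (x + of_int n * (2 * pi)) = cis x"
proof -
  have "cis (of_int n * (2 * pi)) = 1"
    by (simp add: complex_eq_iff mult.commute[of _ "2 * pi"] cos_int_2pin sin_int_2pin)
  then show ?thesis by (simp add: cis_mult[symmetric])
qed

lemma Diff1_plusD:
  assumes "g \<in> carrier Diff1_plus"
  shows "C1_circle_map g" "inj_on g circle" "x \<in> circle \<Longrightarrow> g x \<in> circle"
    "x \<in> circle \<Longrightarrow> 0 < circle_deriv g x"
  using assms by (auto simp: Diff1_plus_def Bij_def bij_betw_def)

text \<open>
  The derivative is part of the definition, so that two lifts of the same map differ by a constant.
\<close>

definition is_lift :: "(complex \<Rightarrow> complex) \<Rightarrow> (real \<Rightarrow> real) \<Rightarrow> bool" where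
  "is_lift g G \<longleftrightarrow> (\<forall>t. g (cis t) = cis (G t))
     \<and> (\<forall>t. (G has_real_derivative circle_deriv g (cis t)) (at t))
     \<and> (\<forall>t. G (t + 2 * pi) = G t + 2 * pi)"

lemma is_liftD:
  assumes "is_lift g G"
  shows "g (cis t) = cis (G t)" "(G has_real_derivative circle_deriv g (cis t)) (at t)"
    "G (t + 2 * pi) = G t + 2 * pi"
  using assms by (auto simp: is_lift_def)

lemma strict_mono_of_circle_deriv:
  assumes "g \<in> carrier Diff1_plus" and "\<And>t. (G has_real_derivative circle_deriv g (cis t)) (at t)"
  shows "strict_mono G"
proof (rule strict_monoI)
  fix x y :: real assume "x < y"
  then show "G x < G y"
  proof (rule DERIV_pos_imp_increasing)
    show "\<exists>y. (G has_real_derivative y) (at t) \<and> 0 < y" for t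
      using assms(2)[of t] Diff1_plusD(4)[OF assms(1), of "cis t"] by auto
  qed
qed

text \<open>
  A primitive \<open>H\<close> of the derivative along the circle is a lift up to a constant, because \<open>g (cis t) * cis (- H t)\<close>
  has derivative 0. Over one period a lift increases by a multiple of the period; twice or more would make \<open>g\<close>
  take one of its values twice.
\<close>

lemma lift_exists:
  assumes g: "g \<in> carrier Diff1_plus"
  shows "\<exists>G. is_lift g G"
proof -
  note C1 = Diff1_plusD(1)[OF g]
  let ?d = "\<lambda>t. circle_deriv g (cis t)"
  have "isCont ?d t" for t
    using circle_deriv_continuous[OF C1] by (simp add: continuous_on_eq_continuous_at)
  then have "\<exists>H. \<forall>t. -\<infinity> < ereal t \<longrightarrow> ereal t < \<infinity> \<longrightarrow> (H has_vector_derivative ?d t) (at t)"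
    by (intro einterval_antiderivative) auto
  then obtain H where H: "\<And>t. (H has_real_derivative ?d t) (at t)"
    by (auto simp: has_real_derivative_iff_has_vector_derivative)
  define e where "e t = g (cis t) * cis (- H t)" for t
  have "(e has_vector_derivative 0) (at t)" for t
  proof -
    have "((\<lambda>s. cis (- H s)) has_vector_derivative (- ?d t) *\<^sub>R (\<i> * cis (- H t))) (at t)"
      by (intro has_vector_derivative_cis_comp DERIV_minus H)
    from has_vector_derivative_mult[OF has_vector_derivative_circle_deriv[OF C1] this]
    show ?thesis unfolding e_def by (simp add: scaleR_conv_of_real algebra_simps)
  qed
  then obtain c where c: "\<And>t. e t = c"
    using has_vector_derivative_zero_constant[of UNIV e] by auto
  have gc: "g (cis t) = c * cis (H t)" for t
    using c[of t] by (simp add: e_def mult.assoc cis_mult flip: c[of t])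
  have "norm c = 1" using Diff1_plusD(3)[OF g, of "cis 0"] gc[of 0] by (simp add: norm_mult)
  then obtain \<theta> where \<theta>: "c = cis \<theta>" using circle_obtain_cis[of c] by auto
  define G where "G t = H t + \<theta>" for t
  have gG: "g (cis t) = cis (G t)" for t by (simp add: gc \<theta> G_def cis_mult add.commute)
  have dG: "(G has_real_derivative ?d t) (at t)" for t
    unfolding G_def using DERIV_add[OF H DERIV_const] by simp
  have sm: "strict_mono G" by (rule strict_mono_of_circle_deriv[OF g dG])
  have "((\<lambda>s. G (s + 2 * pi) - G s) has_real_derivative 0) (at t)" for t
  proof -
    have "((\<lambda>s. G (s + 2 * pi)) has_real_derivative ?d (t + 2 * pi) * 1) (at t)"
      by (rule DERIV_chain2[OF dG]) (auto intro!: derivative_eq_intros)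
    from DERIV_diff[OF this dG] show ?thesis using cis_add_int[of t 1] by simp
  qed
  then have const: "G (t + 2 * pi) - G t = G (0 + 2 * pi) - G 0" for t
    using DERIV_isconst_all[of "\<lambda>s. G (s + 2 * pi) - G s" t 0] by blast
  have "cis (G (2 * pi)) = cis (G 0)" using gG[of "2 * pi"] gG[of 0] by simp
  then obtain n :: int where n: "G (2 * pi) = G 0 + of_int n * (2 * pi)" using cis_eq_imp by blast
  have "G 0 < G (2 * pi)" using sm by (simp add: strict_mono_less)
  then have "0 < n" using n by (simp add: zero_less_mult_iff)
  moreover have "\<not> 2 \<le> n"
  proof
    assume "2 \<le> n"
    then have "2 * (2 * pi) \<le> of_int n * (2 * pi)" by (intro mult_right_mono) auto
    then have lt: "G 0 < G 0 + 2 * pi" "G 0 + 2 * pi < G (2 * pi)" using n pi_gt_zero by linarith+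
    have "continuous_on {0..2 * pi} G"
      using dG by (meson DERIV_isCont continuous_at_imp_continuous_on)
    then obtain t where t: "0 \<le> t" "t \<le> 2 * pi" "G t = G 0 + 2 * pi"
      using IVT'[of G 0 "G 0 + 2 * pi" "2 * pi"] lt by auto
    then have "t \<noteq> 0" "t \<noteq> 2 * pi" using lt by auto
    then have t': "0 < t" "t < 2 * pi" using t by auto
    have "g (cis t) = g (cis 0)" unfolding gG using t(3) cis_add_int[of "G 0" 1] by simp
    then have "cis t = cis 0" using Diff1_plusD(2)[OF g] by (auto dest!: inj_onD)
    then obtain k :: int where k: "t = of_int k * (2 * pi)" using cis_eq_imp[of t 0] by auto
    have "0 < k" using t'(1) k by (simp add: zero_less_mult_iff)
    moreover have "of_int k * (2 * pi) < 1 * (2 * pi)" using t'(2) k by simp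
    then have "k < 1" by (simp only: mult_less_cancel_right) auto
    ultimately show False by simp
  qed
  ultimately have "n = 1" by simp
  then have "G (t + 2 * pi) = G t + 2 * pi" for t using const[of t] n by simp
  then show ?thesis using gG dG unfolding is_lift_def by blast
qed

lemma lift_unique:
  assumes "is_lift g G" "is_lift g H"
  shows "\<exists>n::int. \<forall>t. G t = H t + of_int n * (2 * pi)"
proof -
  have "((\<lambda>s. G s - H s) has_real_derivative 0) (at t)" for t
    using DERIV_diff[OF is_liftD(2)[OF assms(1)] is_liftD(2)[OF assms(2)]] by simp
  then have const: "G t - H t = G 0 - H 0" for t
    using DERIV_isconst_all[of "\<lambda>s. G s - H s" t 0] by blast
  have "cis (G 0) = cis (H 0)" using is_liftD(1)[OF assms(1)] is_liftD(1)[OF assms(2)] by metis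
  then obtain n :: int where "G 0 = H 0 + of_int n * (2 * pi)" using cis_eq_imp by blast
  then have "G t = H t + of_int n * (2 * pi)" for t using const[of t] by linarith
  then show ?thesis by blast
qed

text \<open>
  Only the composition with \<open>cis\<close> is known to be continuous; \<open>cis\<close> is a closed map on a compact period.
\<close>

lemma continuous_on_circle_map:
  assumes "C1_circle_map g" shows "continuous_on circle g"
proof -
  have c: "continuous_on {0..2 * pi} (\<lambda>t. g (cis t))"
    using assms has_vector_derivative_circle_deriv
    by (intro continuous_at_imp_continuous_on ballI has_vector_derivative_continuous) blast
  have "closed (g -` C \<inter> circle)" if "closed C" for C
  proof -
    have "closed ((\<lambda>t. g (cis t)) -` C \<inter> {0..2 * pi})"
      using c that by (simp add: continuous_on_closed_vimage)
    then have "compact ((\<lambda>t. g (cis t)) -` C \<inter> {0..2 * pi})"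
      using closed_Int_compact[of _ "{0..2 * pi}"] by (fastforce simp: Int_assoc)
    then have "compact (cis ` ((\<lambda>t. g (cis t)) -` C \<inter> {0..2 * pi}))"
      by (intro compact_continuous_image continuous_intros)
    also have "cis ` ((\<lambda>t. g (cis t)) -` C \<inter> {0..2 * pi}) = g -` C \<inter> circle"
    proof (intro equalityI subsetI)
      fix x assume x: "x \<in> g -` C \<inter> circle"
      then obtain s where s: "x = cis s" using circle_obtain_cis by blast
      define t where "t = s - of_int \<lfloor>s / (2 * pi)\<rfloor> * (2 * pi)"
      have "t \<in> {0..2 * pi}"
        using floor_divide_lower[of "2 * pi" s] floor_divide_upper[of "2 * pi" s] by (auto simp: t_def algebra_simps)
      moreover have "cis t = x" using cis_add_int[of s "- \<lfloor>s / (2 * pi)\<rfloor>"] by (simp add: t_def s)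
      ultimately show "x \<in> cis ` ((\<lambda>t. g (cis t)) -` C \<inter> {0..2 * pi})" using x by force
    qed auto
    finally show ?thesis by (rule compact_imp_closed)
  qed
  then show ?thesis by (subst continuous_on_closed_vimage) auto
qed

lemma measurable_circle_map:
  assumes "C1_circle_map g"
  shows "g \<in> measurable (restrict_space borel circle) (restrict_space borel circle)"
proof (rule measurable_restrict_space2)
  show "g \<in> space (restrict_space borel circle) \<rightarrow> circle"
    using assms by (auto simp: C1_circle_map_def space_restrict_space)
  show "g \<in> borel_measurable (restrict_space borel circle)"
    by (rule borel_measurable_continuous_on_restrict[OF continuous_on_circle_map[OF assms]])
qed

locale circle_group =
  fixes \<Gamma> :: "(complex \<Rightarrow> complex) set"
  assumes subgroup: "subgroup \<Gamma> Diff1_plus"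
begin

lemma carrier: "g \<in> \<Gamma> \<Longrightarrow> g \<in> carrier Diff1_plus"
  using subgroup.subset[OF subgroup] by blast

lemma mult_in: "g \<in> \<Gamma> \<Longrightarrow> h \<in> \<Gamma> \<Longrightarrow> compose circle g h \<in> \<Gamma>"
  using subgroup.m_closed[OF subgroup, of g h] carrier[of g] carrier[of h]
  by (auto simp: Diff1_plus_def BijGroup_def)

lemma one_in: "(\<lambda>x\<in>circle. x) \<in> \<Gamma>"
  using subgroup.one_closed[OF subgroup] by (simp add: Diff1_plus_def BijGroup_def)

lemma inverse_in:
  assumes "g \<in> \<Gamma>"
  obtains h where "h \<in> \<Gamma>" "compose circle g h = (\<lambda>x\<in>circle. x)"
proof -
  have "inv\<^bsub>Diff1_plus\<^esub> g \<in> \<Gamma>" "g \<otimes>\<^bsub>Diff1_plus\<^esub> inv\<^bsub>Diff1_plus\<^esub> g = \<one>\<^bsub>Diff1_plus\<^esub>"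
    using subgroup.m_inv_closed[OF subgroup assms] group.r_inv[OF group_Diff1_plus carrier[OF assms]] by auto
  then show ?thesis using that carrier assms by (auto simp: Diff1_plus_def BijGroup_def)
qed

definition lifts :: "(real \<Rightarrow> real) set" where
  "lifts = {G. \<exists>g\<in>\<Gamma>. is_lift g G}"

lemma lift_compose:
  assumes "g \<in> \<Gamma>" "h \<in> \<Gamma>" and G: "is_lift g G" and H: "is_lift h H"
  shows "is_lift (compose circle g h) (\<lambda>t. G (H t))"
proof -
  have "((\<lambda>t. G (H t)) has_real_derivative circle_deriv (compose circle g h) (cis t)) (at t)" for t
  proof -
    have "circle_deriv (compose circle g h) (cis t) = circle_deriv g (h (cis t)) * circle_deriv h (cis t)"
      using Diff1_plusD(1) carrier assms by (intro C1_circle_map_comp(2)) (auto simp: compose_def)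
    then show ?thesis using DERIV_chain2[OF is_liftD(2)[OF G] is_liftD(2)[OF H]] is_liftD(1)[OF H] by simp
  qed
  then show ?thesis using is_liftD[OF G] is_liftD[OF H] by (simp add: is_lift_def compose_def)
qed

lemma lift_shift:
  assumes "is_lift g G" shows "is_lift g (\<lambda>t. G t + of_int n * (2 * pi))"
  using is_liftD[OF assms] DERIV_add[OF is_liftD(2)[OF assms] DERIV_const]
  by (auto simp: is_lift_def cis_add_int)

lemma lift_one: "is_lift (\<lambda>x\<in>circle. x) (\<lambda>t. t)"
  using C1_circle_map_id(2)[of "\<lambda>x\<in>circle. x"] by (simp add: is_lift_def)

sublocale lift_group lifts "2 * pi"
proof
  show "(\<lambda>x. x + 2 * pi) \<in> lifts"
    using lift_shift[OF lift_one, of 1] one_in by (auto simp: lifts_def)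
  show "(\<lambda>x. f (g x)) \<in> lifts" if "f \<in> lifts" "g \<in> lifts" for f g
    using that mult_in lift_compose unfolding lifts_def by blast
  show sm: "strict_mono f" if "f \<in> lifts" for f
    using that strict_mono_of_circle_deriv carrier is_liftD(2) unfolding lifts_def by blast
  show "continuous_on UNIV f" if "f \<in> lifts" for f
    using that is_liftD(2) unfolding lifts_def
    by (auto intro!: continuous_at_imp_continuous_on DERIV_isCont)
  show "f (x + 2 * pi) = f x + 2 * pi" if "f \<in> lifts" for f x
    using that is_liftD(3) unfolding lifts_def by blast
  show "\<exists>h\<in>lifts. \<forall>x. h (f x) = x \<and> f (h x) = x" if f: "f \<in> lifts" for f
  proof -
    obtain g where g: "g \<in> \<Gamma>" "is_lift g f" using f by (auto simp: lifts_def)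
    obtain h where h: "h \<in> \<Gamma>" "compose circle g h = (\<lambda>x\<in>circle. x)" using inverse_in[OF g(1)] by blast
    obtain H where H: "is_lift h H" using lift_exists[OF carrier[OF h(1)]] by blast
    have "is_lift (\<lambda>x\<in>circle. x) (\<lambda>t. f (H t))" using lift_compose[OF g(1) h(1) g(2) H] h(2) by simp
    then obtain n :: int where n: "\<And>t. f (H t) = t + of_int n * (2 * pi)" using lift_unique[OF _ lift_one] by blast
    define k where "k t = H (t + of_int (- n) * (2 * pi))" for t
    have k: "f (k t) = t" for t using n[of "t + of_int (- n) * (2 * pi)"] by (simp add: k_def)
    \<comment> \<open>needed because only additive shifts of lifts are known to be lifts\<close>
    have "k = (\<lambda>t. H t + of_int (- n) * (2 * pi))"
    proof
      fix t
      have "f (k t + of_int n * (2 * pi)) = f (k t) + of_int n * (2 * pi)" for t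
      proof (induction n rule: int_induct[where k = 0])
        case (step1 i)
        then show ?case using is_liftD(3)[OF g(2), of "k t + of_int i * (2 * pi)"] by (simp add: algebra_simps)
      next
        case (step2 i)
        then show ?case using is_liftD(3)[OF g(2), of "k t + of_int (i - 1) * (2 * pi)"] by (simp add: algebra_simps)
      qed simp
      then have "f (k t + of_int n * (2 * pi)) = f (H t)" using k n by simp
      then have "k t + of_int n * (2 * pi) = H t" using sm[OF f] by (simp add: strict_mono_eq)
      then show "k t = H t + of_int (- n) * (2 * pi)" by simp
    qed
    then have "k \<in> lifts" using lift_shift[OF H, of "- n"] h(1) by (auto simp: lifts_def)
    moreover have "k (f x) = x" for x using k[of "f x"] sm[OF f] by (simp add: strict_mono_eq)
    ultimately show ?thesis using k by blast
  qed
qed simp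

lemma lifts_C1:
  assumes "G \<in> lifts"
  shows "(G has_real_derivative deriv G t) (at t)" "continuous_on UNIV (deriv G)" "0 < deriv G t"
proof -
  obtain g where g: "g \<in> \<Gamma>" "is_lift g G" using assms by (auto simp: lifts_def)
  have d: "deriv G = (\<lambda>t. circle_deriv g (cis t))"
    using is_liftD(2)[OF g(2)] by (intro ext DERIV_imp_deriv)
  show "(G has_real_derivative deriv G t) (at t)" using is_liftD(2)[OF g(2)] by (simp add: d)
  show "continuous_on UNIV (deriv G)" unfolding d
    by (rule circle_deriv_continuous[OF Diff1_plusD(1)[OF carrier[OF g(1)]]])
  show "0 < deriv G t" unfolding d by (rule Diff1_plusD(4)[OF carrier[OF g(1)]]) simp
qed

lemma measurable_in: "g \<in> \<Gamma> \<Longrightarrow> g \<in> measurable (restrict_space borel circle) (restrict_space borel circle)"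
  by (intro measurable_circle_map Diff1_plusD(1) carrier)

lemma finite_orbit_measure:
  assumes fin: "finite ((\<lambda>G. residue (G x)) ` lifts)"
  shows "\<exists>m. circle_prob_measure m \<and> preserves_measure \<Gamma> m"
proof -
  define Z where "Z = (\<lambda>G. cis (G x)) ` lifts"
  have cr: "cis (residue y) = cis y" for y
    using cis_add_int[of y "- \<lfloor>y / (2 * pi)\<rfloor>"] by (simp add: residue_def)
  have "Z = cis ` ((\<lambda>G. residue (G x)) ` lifts)" by (simp add: Z_def image_image cr)
  then have "finite Z" using fin by simp
  have maps: "g ` Z \<subseteq> Z" if g: "g \<in> \<Gamma>" for g
  proof
    fix z assume "z \<in> g ` Z"
    then obtain H where H: "H \<in> lifts" "z = g (cis (H x))" by (auto simp: Z_def)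
    obtain G where G: "is_lift g G" using lift_exists carrier g by blast
    then have "G \<in> lifts" using g by (auto simp: lifts_def)
    then have "(\<lambda>t. G (H t)) \<in> lifts" using comp H(1) by blast
    moreover have "z = cis (G (H x))" using H(2) is_liftD(1)[OF G] by simp
    ultimately show "z \<in> Z" unfolding Z_def by (intro image_eqI[of _ _ "\<lambda>t. G (H t)"]) auto
  qed
  show ?thesis
  proof (rule invariant_measure_of_finite_orbit[OF \<open>finite Z\<close>])
    show "Z \<noteq> {}" using shift by (auto simp: Z_def)
    show sub: "Z \<subseteq> circle" by (auto simp: Z_def)
    show "bij_betw g Z Z" if g: "g \<in> \<Gamma>" for g
    proof -
      have "inj_on g Z" using Diff1_plusD(2)[OF carrier[OF g]] sub by (rule inj_on_subset)
      then show ?thesis using endo_inj_surj[OF \<open>finite Z\<close> maps[OF g]] by (simp add: bij_betw_def)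
    qed
  qed (rule measurable_in)
qed

lemma cocycle_measure:
  assumes F: "mono F" "\<And>x. F (x + 2 * pi) = F x + (1::real)" "\<And>G. G \<in> lifts \<Longrightarrow> \<exists>c. \<forall>x. F (G x) = F x + c"
  shows "\<exists>m. circle_prob_measure m \<and> preserves_measure \<Gamma> m"
proof (rule invariant_measure_of_cocycle[OF F(1,2) _ measurable_in])
  fix g assume g: "g \<in> \<Gamma>"
  then obtain G where G: "is_lift g G" using lift_exists carrier by blast
  then have GL: "G \<in> lifts" using g by (auto simp: lifts_def)
  have "surj G" using inverse[OF GL] by (metis surjI)
  then show "\<exists>G c. strict_mono G \<and> surj G \<and> (\<forall>x. g (cis x) = cis (G x)) \<and> (\<forall>x. F (G x) = F x + c)"
    using mono[OF GL] is_liftD(1)[OF G] F(3)[OF GL] by blast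
qed

lemma hyperbolic_lift:
  assumes no: "\<nexists>m. circle_prob_measure m \<and> preserves_measure \<Gamma> m"
  obtains G where "G \<in> lifts" "\<exists>x. \<exists>n::int. G x = x + of_int n * (2 * pi)"
    "\<And>x n. G x = x + of_int n * (2 * pi) \<Longrightarrow> deriv G x \<noteq> 1"
proof -
  have orbits: "infinite ((\<lambda>G. residue (G x)) ` lifts)" for x using finite_orbit_measure no by blast
  obtain K where K: "closed K" "K \<noteq> {}" "\<And>g x. g \<in> lifts \<Longrightarrow> x \<in> K \<Longrightarrow> g x \<in> K"
    "\<And>x V. x \<in> K \<Longrightarrow> open V \<Longrightarrow> V \<inter> K \<noteq> {} \<Longrightarrow> \<exists>g\<in>lifts. g x \<in> V"
    using minimal_closed_invariant_set by metis
  interpret minimal_lift_group lifts "2 * pi" K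
  proof
    obtain x where x: "x \<in> K" using K(2) by blast
    have "residue (G x) \<in> K \<inter> {0..<2 * pi}" if "G \<in> lifts" for G
      using K(3)[OF shift_int[of "- \<lfloor>G x / (2 * pi)\<rfloor>"] K(3)[OF that x]] residue_range[of "G x"]
      by (simp add: residue_def)
    then have "(\<lambda>G. residue (G x)) ` lifts \<subseteq> K \<inter> {0..<2 * pi}" by blast
    then show "infinite (K \<inter> {0..<2 * pi})" using orbits[of x] finite_subset by blast
  qed (use K in blast)+
  have "\<not> (\<forall>N. \<exists>\<theta>. stepping \<theta> \<and> (\<theta> ^^ N) 0 \<le> 2 * pi)"
  proof
    assume "\<forall>N. \<exists>\<theta>. stepping \<theta> \<and> (\<theta> ^^ N) 0 \<le> 2 * pi"
    then obtain F :: "real \<Rightarrow> real" where "mono F" "\<And>x. F (x + 2 * pi) = F x + 1"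
      "\<And>G. G \<in> lifts \<Longrightarrow> \<exists>c. \<forall>x. F (G x) = F x + c" using small_steps_imp_cocycle by metis
    then show False using cocycle_measure no by blast
  qed
  then obtain N where N: "\<And>\<theta>. stepping \<theta> \<Longrightarrow> 2 * pi < (\<theta> ^^ N) 0" by (auto simp: not_le)
  obtain A B where AB: "finite A" "finite B" "A \<noteq> {}"
    "\<And>\<epsilon>. \<epsilon> > 0 \<Longrightarrow> \<exists>h\<in>lifts. \<forall>x. \<not> near B \<epsilon> x \<longrightarrow> near A \<epsilon> (h x)"
    using finite_concentration[OF N] by metis
  obtain f A' B' \<eta> where pp: "ping_pong lifts (2 * pi) f A' B' \<eta>" "\<And>c. A' c \<noteq> {}"
    using ping_pong_exists[OF orbits AB(1,2,4,3)] by metis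
  interpret ping_pong lifts "2 * pi" f A' B' \<eta> by (rule pp(1))
  interpret C1_ping_pong lifts "2 * pi" f A' B' \<eta> by unfold_locales (rule lifts_C1; assumption)+
  show ?thesis using hyperbolic_element[OF pp(2)] that by blast
qed

end

theorem mainTheorem4:
  fixes \<Gamma> :: "(complex \<Rightarrow> complex) set"
  assumes "subgroup \<Gamma> Diff1_plus"
    and "countable \<Gamma>"
    and "\<nexists>m. circle_prob_measure m \<and> preserves_measure \<Gamma> m"
  shows "\<exists>g\<in>\<Gamma>. (\<exists>x\<in>circle. g x = x) \<and>
           (\<forall>x\<in>circle. g x = x \<longrightarrow> hyperbolic_fixed_point g x)"
proof -
  interpret circle_group \<Gamma> by (rule circle_group.intro) (rule assms(1))
  obtain G where G: "G \<in> lifts" "\<exists>x. \<exists>n::int. G x = x + of_int n * (2 * pi)"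
    "\<And>x n. G x = x + of_int n * (2 * pi) \<Longrightarrow> deriv G x \<noteq> 1"
    using hyperbolic_lift[OF assms(3)] by metis
  obtain g where g: "g \<in> \<Gamma>" "is_lift g G" using G(1) by (auto simp: lifts_def)
  obtain x and n :: int where "G x = x + of_int n * (2 * pi)" using G(2) by blast
  then have "g (cis x) = cis x" using is_liftD(1)[OF g(2)] cis_add_int by simp
  moreover have "hyperbolic_fixed_point g y" if y: "y \<in> circle" "g y = y" for y
  proof -
    obtain t where t: "y = cis t" using circle_obtain_cis[OF y(1)] by blast
    have "cis (G t) = cis t" using is_liftD(1)[OF g(2)] y(2) t by simp
    then obtain n :: int where "G t = t + of_int n * (2 * pi)" using cis_eq_imp by blast
    then have "deriv G t \<noteq> 1" by (rule G(3))
    then show ?thesis using DERIV_imp_deriv[OF is_liftD(2)[OF g(2)], of t] y t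
      by (simp add: hyperbolic_fixed_point_def)
  qed
  ultimately show ?thesis using g(1) by (intro bexI[of _ g]) (auto intro!: bexI[of _ "cis x"])
qed

end
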